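(* Let $2\le n\le4$ and let $(\Sigma^n,\langle\,,\rangle)$ be a connected parabolic Riemannian manifold with non-negative scalar curvature. There exists no codimension two trapped immersion $\psi:\Sigma^n\to\Lambda^+\subset\mathbb{L}^{n+2}$ with image in the future component $\Lambda^+$ of the light cone for which $\psi^*(\langle\,,\rangle_{\mathbb{L}^{n+2}})=\lambda^2\langle\,,\rangle$, where the conformal factor $\lambda>0$ is a smooth function bounded from above.
   Context: A (not necessarily complete) Riemannian manifold is parabolic if the only subharmonic functions on it which are bounded from above are the constants. $\mathbb{L}^{n+2}$ is $\mathbb{R}^{n+2}$ with metric $-dx_1^2+dx_2^2+\cdots+dx_{n+2}^2$, standard basis $\mathbf{e}_1,\dots,\mathbf{e}_{n+2}$, and time orientation given by $\mathbf{e}_1$; $\Lambda^+=\{x\in\mathbb{L}^{n+2}:\langle x,x\rangle=0,\ x_1>0\}$. For a spacelike immersion $\psi:\Sigma^n\to\Lambda^+\subset\mathbb{L}^{n+2}$ (with $\Sigma$ given the induced metric), put $u=-\langle\psi,\mathbf{e}_1\rangle>0$. There is a globally defined future-pointing null normal frame $\xi=\psi$, $\eta=-\frac{1+\|\nabla u\|^2}{2u^2}\xi+\frac1u\mathbf{e}_1^\perp$ with $\langle\xi,\eta\rangle=-1$, where $\nabla u$, $\|\cdot\|$ refer to the induced metric and $\perp$ denotes the component normal to $\Sigma$. For a normal field $\zeta$ set $A_\zeta X=(\overline\nabla_X\zeta)^\top$ ($\overline\nabla$ the Levi-Civita connection of $\mathbb{L}^{n+2}$, $\top$ the tangential component) and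 $\theta_\zeta=\frac1n\operatorname{tr}A_\zeta$. The immersion is trapped if, on $\Sigma$, either both $\theta_\xi<0$ and $\theta_\eta<0$, or both $\theta_\xi>0$ and $\theta_\eta>0$. *)

theory Defs
  imports "HOL-Analysis.Analysis"
begin

section \<open>Smooth maps on open subsets of \<open>\<real>\<^sup>n\<close>\<close>

definition partial_deriv ::
    "'n::finite \<Rightarrow> (real^'n \<Rightarrow> 'b::real_normed_vector) \<Rightarrow> real^'n \<Rightarrow> 'b" where
  "partial_deriv i f x = frechet_derivative f (at x) (axis i 1)"

primrec Ck_on ::
    "nat \<Rightarrow> (real^'n::finite) set \<Rightarrow> (real^'n \<Rightarrow> 'b::real_normed_vector) \<Rightarrow> bool" where
  "Ck_on 0 S f \<longleftrightarrow> continuous_on S f"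
| "Ck_on (Suc k) S f \<longleftrightarrow>
     (\<forall>x\<in>S. f differentiable (at x)) \<and> (\<forall>i. Ck_on k S (partial_deriv i f))"

definition smooth_on ::
    "(real^'n::finite) set \<Rightarrow> (real^'n \<Rightarrow> 'b::real_normed_vector) \<Rightarrow> bool" where
  "smooth_on S f \<longleftrightarrow> (\<forall>k. Ck_on k S f)"


section \<open>Smooth manifolds\<close>

text \<open>
  A smooth \<open>n\<close>-manifold is a Hausdorff, second countable topological space with a smooth atlas
  (not required to be maximal). A chart is a pair of its domain and its coordinate map; the
  coordinate map is only meaningful on the domain.
\<close>

type_synonym ('a, 'n) chart = "'a set \<times> ('a \<Rightarrow> real^'n)"

definition codomain :: "('a, 'n) chart \<Rightarrow> (real^'n) set" where
  "codomain c = snd c ` fst c"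

definition in_chart :: "('a, 'n) chart \<Rightarrow> ('a \<Rightarrow> 'b) \<Rightarrow> real^'n \<Rightarrow> 'b" where
  "in_chart c f = f \<circ> inv_into (fst c) (snd c)"

abbreviation transition :: "('a, 'n) chart \<Rightarrow> ('a, 'n) chart \<Rightarrow> real^'n \<Rightarrow> real^'n" where
  "transition c d \<equiv> in_chart c (snd d)"

definition smooth_manifold :: "'a topology \<Rightarrow> ('a, 'n::finite) chart set \<Rightarrow> bool" where
  "smooth_manifold X \<A> \<longleftrightarrow>
     Hausdorff_space X \<and> second_countable X \<and>
     (\<Union>c\<in>\<A>. fst c) = topspace X \<and>
     (\<forall>c\<in>\<A>. openin X (fst c) \<and> open (codomain c) \<and>
        homeomorphic_map (subtopology X (fst c)) (top_of_set (codomain c)) (snd c)) \<and>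
     (\<forall>c\<in>\<A>. \<forall>d\<in>\<A>. smooth_on (snd c ` (fst c \<inter> fst d)) (transition c d))"

definition smooth_map ::
    "('a, 'n::finite) chart set \<Rightarrow> ('a \<Rightarrow> 'b::real_normed_vector) \<Rightarrow> bool" where
  "smooth_map \<A> f \<longleftrightarrow> (\<forall>c\<in>\<A>. smooth_on (codomain c) (in_chart c f))"


section \<open>Riemannian geometry in local coordinates\<close>

text \<open>
  Here \<open>G\<close> denotes the matrix \<open>(g\<^sub>i\<^sub>j)\<close> of a metric in a chart, as a function of the coordinates.
\<close>

type_synonym 'n local_metric = "real^'n \<Rightarrow> real^'n^'n"

definition pos_def_matrix :: "real^'n::finite^'n \<Rightarrow> bool" where
  "pos_def_matrix B \<longleftrightarrow> transpose B = B \<and> (\<forall>v. v \<noteq> 0 \<longrightarrow> v \<bullet> (B *v v) > 0)"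

text \<open>\<open>christoffel G k i j\<close> is \<open>\<Gamma>\<^sup>k\<^sub>i\<^sub>j\<close>, i.e. \<open>\<nabla>\<^bsub>\<partial>i\<^esub> \<partial>\<^sub>j = \<Sum>\<^sub>k \<Gamma>\<^sup>k\<^sub>i\<^sub>j \<partial>\<^sub>k\<close>.\<close>

definition christoffel ::
    "'n::finite local_metric \<Rightarrow> 'n \<Rightarrow> 'n \<Rightarrow> 'n \<Rightarrow> real^'n \<Rightarrow> real" where
  "christoffel G k i j x =
     (\<Sum>l\<in>UNIV. matrix_inv (G x) $ k $ l *
        (partial_deriv i (\<lambda>y. G y $ j $ l) x + partial_deriv j (\<lambda>y. G y $ i $ l) x
          - partial_deriv l (\<lambda>y. G y $ i $ j) x)) / 2"

text \<open>
  \<open>riemann_tensor G l i j k\<close> is the \<open>l\<close>-th component of \<open>R(\<partial>\<^sub>i, \<partial>\<^sub>j)\<partial>\<^sub>k\<close>, with the convention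
  \<open>R(X, Y)Z = \<nabla>\<^sub>X \<nabla>\<^sub>Y Z - \<nabla>\<^sub>Y \<nabla>\<^sub>X Z - \<nabla>\<^bsub>[X, Y]\<^esub> Z\<close>, so that round spheres have positive scalar
  curvature with \<open>Ric(Y, Z) = tr (X \<mapsto> R(X, Y)Z)\<close>.
\<close>

definition riemann_tensor ::
    "'n::finite local_metric \<Rightarrow> 'n \<Rightarrow> 'n \<Rightarrow> 'n \<Rightarrow> 'n \<Rightarrow> real^'n \<Rightarrow> real" where
  "riemann_tensor G l i j k x =
     partial_deriv i (christoffel G l j k) x - partial_deriv j (christoffel G l i k) x
     + (\<Sum>m\<in>UNIV. christoffel G l i m x * christoffel G m j k x
                 - christoffel G l j m x * christoffel G m i k x)"

definition ricci :: "'n::finite local_metric \<Rightarrow> 'n \<Rightarrow> 'n \<Rightarrow> real^'n \<Rightarrow> real" where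
  "ricci G j k x = (\<Sum>i\<in>UNIV. riemann_tensor G i i j k x)"

definition scalar_curvature :: "'n::finite local_metric \<Rightarrow> real^'n \<Rightarrow> real" where
  "scalar_curvature G x =
     (\<Sum>j\<in>UNIV. \<Sum>k\<in>UNIV. matrix_inv (G x) $ j $ k * ricci G j k x)"

definition gradient :: "'n::finite local_metric \<Rightarrow> (real^'n \<Rightarrow> real) \<Rightarrow> real^'n \<Rightarrow> real^'n" where
  "gradient G f x = matrix_inv (G x) *v (\<chi> i. partial_deriv i f x)"

definition norm_sq :: "'n::finite local_metric \<Rightarrow> real^'n \<Rightarrow> real^'n \<Rightarrow> real" where
  "norm_sq G x v = v \<bullet> (G x *v v)"

definition hessian ::
    "'n::finite local_metric \<Rightarrow> (real^'n \<Rightarrow> real) \<Rightarrow> 'n \<Rightarrow> 'n \<Rightarrow> real^'n \<Rightarrow> real" where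
  "hessian G f i j x =
     partial_deriv i (partial_deriv j f) x - (\<Sum>k\<in>UNIV. christoffel G k i j x * partial_deriv k f x)"

definition laplacian :: "'n::finite local_metric \<Rightarrow> (real^'n \<Rightarrow> real) \<Rightarrow> real^'n \<Rightarrow> real" where
  "laplacian G f x = (\<Sum>i\<in>UNIV. \<Sum>j\<in>UNIV. matrix_inv (G x) $ i $ j * hessian G f i j x)"


section \<open>Riemannian manifolds\<close>

text \<open>
  A Riemannian metric is given by its matrix in every chart of the atlas, subject to the
  transformation law of covariant 2-tensors.
\<close>

type_synonym ('a, 'n) metric = "('a, 'n) chart \<Rightarrow> 'n local_metric"

definition riemannian_metric ::
    "('a, 'n::finite) chart set \<Rightarrow> ('a, 'n) metric \<Rightarrow> bool" where
  "riemannian_metric \<A> g \<longleftrightarrow>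
     (\<forall>c\<in>\<A>. smooth_on (codomain c) (g c) \<and> (\<forall>x\<in>codomain c. pos_def_matrix (g c x))) \<and>
     (\<forall>c\<in>\<A>. \<forall>d\<in>\<A>. \<forall>x\<in>snd c ` (fst c \<inter> fst d).
        let J = matrix (frechet_derivative (transition c d) (at x))
        in g c x = transpose J ** g d (transition c d x) ** J)"

definition nonneg_scalar_curvature ::
    "('a, 'n::finite) chart set \<Rightarrow> ('a, 'n) metric \<Rightarrow> bool" where
  "nonneg_scalar_curvature \<A> g \<longleftrightarrow> (\<forall>c\<in>\<A>. \<forall>x\<in>codomain c. 0 \<le> scalar_curvature (g c) x)"

definition subharmonic ::
    "('a, 'n::finite) chart set \<Rightarrow> ('a, 'n) metric \<Rightarrow> ('a \<Rightarrow> real) \<Rightarrow> bool" where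
  "subharmonic \<A> g f \<longleftrightarrow>
     smooth_map \<A> f \<and> (\<forall>c\<in>\<A>. \<forall>x\<in>codomain c. 0 \<le> laplacian (g c) (in_chart c f) x)"

definition parabolic ::
    "'a topology \<Rightarrow> ('a, 'n::finite) chart set \<Rightarrow> ('a, 'n) metric \<Rightarrow> bool" where
  "parabolic X \<A> g \<longleftrightarrow>
     (\<forall>f. subharmonic \<A> g f \<and> bdd_above (f ` topspace X) \<longrightarrow> f constant_on topspace X)"


section \<open>Lorentz--Minkowski space\<close>

text \<open>
  \<open>\<real>\<^sup>n\<^sup>+\<^sup>2\<close> has index type \<open>'n option option\<close>; the index \<open>None\<close> is the time coordinate \<open>x\<^sub>1\<close>.
\<close>

type_synonym 'n minkowski = "real^('n option option)"

definition lorentz :: "'n::finite minkowski \<Rightarrow> 'n minkowski \<Rightarrow> real" where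
  "lorentz v w = - (v $ None * w $ None) + (\<Sum>i\<in>UNIV. v $ Some i * w $ Some i)"

definition e1 :: "'n::finite minkowski" where
  "e1 = axis None 1"

definition future_light_cone :: "('n::finite minkowski) set" where
  "future_light_cone = {x. lorentz x x = 0 \<and> x $ None > 0}"


section \<open>Spacelike immersions into Minkowski space\<close>

text \<open>
  Here \<open>F\<close> is the coordinate expression of an immersion in a chart and \<open>x\<close> a coordinate point.
\<close>

type_synonym 'n local_map = "real^'n \<Rightarrow> 'n minkowski"

definition induced_metric :: "'n::finite local_map \<Rightarrow> 'n local_metric" where
  "induced_metric F x = (\<chi> i j. lorentz (partial_deriv i F x) (partial_deriv j F x))"

definition tangent_space :: "'n::finite local_map \<Rightarrow> real^'n \<Rightarrow> ('n minkowski) set" where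
  "tangent_space F x = range (frechet_derivative F (at x))"

definition tangential :: "'n::finite local_map \<Rightarrow> real^'n \<Rightarrow> 'n minkowski \<Rightarrow> 'n minkowski" where
  "tangential F x v =
     (THE t. t \<in> tangent_space F x \<and> (\<forall>s\<in>tangent_space F x. lorentz (v - t) s = 0))"

definition normal_part :: "'n::finite local_map \<Rightarrow> real^'n \<Rightarrow> 'n minkowski \<Rightarrow> 'n minkowski" where
  "normal_part F x v = v - tangential F x v"

definition height :: "'n::finite local_map \<Rightarrow> real^'n \<Rightarrow> real" where
  "height F x = - lorentz (F x) e1"

definition xi :: "'n::finite local_map \<Rightarrow> 'n local_map" where
  "xi F = F"

definition eta :: "'n::finite local_map \<Rightarrow> 'n local_map" where
  "eta F x =
     (let u = height F x; G = induced_metric F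
      in - ((1 + norm_sq G x (gradient G (height F) x)) / (2 * u\<^sup>2)) *\<^sub>R xi F x
         + (1 / u) *\<^sub>R normal_part F x e1)"

text \<open>
  The Levi-Civita connection of Minkowski space is the flat one, so \<open>\<zeta>\<close> is differentiated
  componentwise. \<open>A\<^sub>\<zeta> X\<close> is a tangent vector of the manifold, expressed in coordinates: it is the
  vector whose image under \<open>dF\<close> is the tangential part of the derivative of \<open>\<zeta>\<close> along \<open>X\<close>.
\<close>

definition shape_operator ::
    "'n::finite local_map \<Rightarrow> 'n local_map \<Rightarrow> real^'n \<Rightarrow> real^'n \<Rightarrow> real^'n" where
  "shape_operator F \<zeta> x X =
     (THE Y. frechet_derivative F (at x) Y = tangential F x (frechet_derivative \<zeta> (at x) X))"

definition null_expansion :: "'n::finite local_map \<Rightarrow> 'n local_map \<Rightarrow> real^'n \<Rightarrow> real" where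
  "null_expansion F \<zeta> x = trace (matrix (shape_operator F \<zeta> x)) / real CARD('n)"

definition spacelike_immersion ::
    "('a, 'n::finite) chart set \<Rightarrow> ('a \<Rightarrow> 'n minkowski) \<Rightarrow> bool" where
  "spacelike_immersion \<A> \<psi> \<longleftrightarrow>
     smooth_map \<A> \<psi> \<and>
     (\<forall>c\<in>\<A>. \<forall>x\<in>codomain c.
        inj (frechet_derivative (in_chart c \<psi>) (at x)) \<and>
        pos_def_matrix (induced_metric (in_chart c \<psi>) x))"

definition trapped ::
    "('a, 'n::finite) chart set \<Rightarrow> ('a \<Rightarrow> 'n minkowski) \<Rightarrow> bool" where
  "trapped \<A> \<psi> \<longleftrightarrow>
     (\<forall>c\<in>\<A>. \<forall>x\<in>codomain c. let F = in_chart c \<psi> in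
        null_expansion F (xi F) x < 0 \<and> null_expansion F (eta F) x < 0) \<or>
     (\<forall>c\<in>\<A>. \<forall>x\<in>codomain c. let F = in_chart c \<psi> in
        null_expansion F (xi F) x > 0 \<and> null_expansion F (eta F) x > 0)"

text \<open>The pullback of the Minkowski metric under \<open>\<psi>\<close> equals \<open>\<lambda>\<^sup>2 g\<close>.\<close>

definition conformal_pullback ::
    "('a, 'n::finite) chart set \<Rightarrow> ('a, 'n) metric \<Rightarrow> ('a \<Rightarrow> 'n minkowski) \<Rightarrow> ('a \<Rightarrow> real) \<Rightarrow> bool"
  where
  "conformal_pullback \<A> g \<psi> lam \<longleftrightarrow>
     (\<forall>c\<in>\<A>. \<forall>x\<in>codomain c.
        induced_metric (in_chart c \<psi>) x = (in_chart c lam x)\<^sup>2 *\<^sub>R g c x)"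

end

theory Submission
  imports Defs
begin

text \<open>
  All spacelike sections of the cone are conformal to each other along the null generators, and the
  proof exploits this by rescaling: if \<open>\<psi>\<close> maps into the cone and induces \<open>\<lambda>\<^sup>2 g\<close>, then
  \<open>\<phi> = \<psi> / \<lambda>\<close> maps into the cone as well and induces \<open>g\<close> itself
  (\<open>induced_metric_rescaled\<close>). So the geometry of both metrics can be read off from a height function.

  For any spacelike immersion into the cone \<open>\<langle>II, \<xi>\<rangle> = - g\<close>, and \<open>B = \<langle>II, \<eta>\<rangle>\<close> (\<open>eta_form\<close>) equals
  \<open>(1 + |\<nabla>u|\<^sup>2) / (2 u\<^sup>2) g - Hess u / u\<close>. The shape operator of \<open>\<xi>\<close> is the identity and the one of \<open>\<eta>\<close> is
  \<open>- B\<close>; hence \<open>\<theta>\<^sub>\<xi> = 1\<close> and trapped means \<open>\<theta>\<^sub>\<eta> > 0\<close>, that is, \<open>tr B < 0\<close>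
  (\<open>null_expansion_xi\<close>, \<open>null_expansion_eta\<close>). On the other hand the Gauss equation in the flat ambient
  space gives the scalar curvature \<open>2 (n - 1) tr B\<close> (\<open>scalar_curvature_eq\<close>).

  For \<open>\<psi>\<close> therefore \<open>tr B < 0\<close>, while for \<open>\<phi>\<close> the curvature hypothesis gives \<open>tr B \<ge> 0\<close>. The heights are
  related by \<open>u = \<lambda> v\<close> and the Laplacians by the formula for a conformal change
  (\<open>laplacian_conformal\<close>), and in the metric \<open>g\<close> one finds
  \<open>\<lambda>\<^sup>2 tr B\<^sub>\<psi> = tr B\<^sub>\<phi> + (4 - n) |\<nabla>\<lambda>|\<^sup>2 / (2 \<lambda>\<^sup>2) - \<Delta>\<lambda> / \<lambda>\<close>.
  If \<open>n \<le> 4\<close>, this forces \<open>\<Delta>\<lambda> > 0\<close> (\<open>laplacian_conformal_factor_pos\<close>). Being bounded above and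
  subharmonic, \<open>\<lambda>\<close> is constant by parabolicity, whence \<open>\<Delta>\<lambda> = 0\<close>, a contradiction.
\<close>


section \<open>Calculus of partial derivatives\<close>

text \<open>
  Partial derivatives are defined from a choice of Frechet derivative, so that two functions
  agreeing near \<open>x\<close> have the same partial derivatives there even if they are not differentiable.
  Identities that hold throughout an open set are differentiated by means of this lemma.
\<close>

lemma partial_deriv_cong:
  assumes "open S" "x \<in> S" "\<And>y. y \<in> S \<Longrightarrow> f y = g y"
  shows "partial_deriv i f x = partial_deriv i g x"
proof -
  have "(f has_derivative f') (at x) \<longleftrightarrow> (g has_derivative f') (at x)" for f'
  proof
    assume "(f has_derivative f') (at x)"
    then show "(g has_derivative f') (at x)"
      by (rule has_derivative_transform_within_open[OF _ assms])
  next
    assume "(g has_derivative f') (at x)"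
    then show "(f has_derivative f') (at x)"
      by (rule has_derivative_transform_within_open[OF _ assms(1,2) assms(3)[symmetric]])
  qed
  then show ?thesis
    unfolding partial_deriv_def frechet_derivative_def by simp
qed

lemma differentiable_cong_open:
  assumes "open S" "x \<in> S" "\<And>y. y \<in> S \<Longrightarrow> f y = g y" "f differentiable (at x)"
  shows "g differentiable (at x)"
  using assms has_derivative_transform_within_open unfolding differentiable_def by blast

lemma partial_deriv_eq:
  "(f has_derivative f') (at x) \<Longrightarrow> partial_deriv i f x = f' (axis i 1)"
  unfolding partial_deriv_def by (metis frechet_derivative_at)

lemma differentiable_imp_has_derivative:
  "f differentiable (at x) \<Longrightarrow> (f has_derivative frechet_derivative f (at x)) (at x)"
  by (simp add: frechet_derivative_works)

lemma frechet_derivative_eq_sum_partial_deriv: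
  fixes f :: "real^'n::finite \<Rightarrow> 'b::real_normed_vector"
  assumes "f differentiable (at x)"
  shows "frechet_derivative f (at x) v = (\<Sum>i\<in>UNIV. v $ i *\<^sub>R partial_deriv i f x)"
proof -
  have lin: "linear (frechet_derivative f (at x))"
    using assms by (rule linear_frechet_derivative)
  have "v = (\<Sum>i\<in>UNIV. v $ i *\<^sub>R axis i 1)"
    using basis_expansion[of v] by (simp add: scalar_mult_eq_scaleR)
  then have "frechet_derivative f (at x) v
      = frechet_derivative f (at x) (\<Sum>i\<in>UNIV. v $ i *\<^sub>R axis i 1)" by simp
  then show ?thesis
    by (simp add: linear_sum[OF lin] linear_cmul[OF lin] partial_deriv_def)
qed

lemma partial_deriv_const [simp]: "partial_deriv i (\<lambda>y. c) = (\<lambda>y. 0)"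
  by (rule ext) (rule partial_deriv_eq, simp)

lemma partial_deriv_add:
  assumes "f differentiable (at x)" "g differentiable (at x)"
  shows "partial_deriv i (\<lambda>y. f y + g y) x = partial_deriv i f x + partial_deriv i g x"
  using partial_deriv_eq[OF has_derivative_add[OF assms[THEN differentiable_imp_has_derivative]]]
  by (simp add: partial_deriv_def)

lemma partial_deriv_diff:
  assumes "f differentiable (at x)" "g differentiable (at x)"
  shows "partial_deriv i (\<lambda>y. f y - g y) x = partial_deriv i f x - partial_deriv i g x"
  using partial_deriv_eq[OF has_derivative_diff[OF assms[THEN differentiable_imp_has_derivative]]]
  by (simp add: partial_deriv_def)

lemma partial_deriv_sum:
  assumes "\<And>k. k \<in> A \<Longrightarrow> f k differentiable (at x)"
  shows "partial_deriv i (\<lambda>y. \<Sum>k\<in>A. f k y) x = (\<Sum>k\<in>A. partial_deriv i (f k) x)"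
proof -
  have "((\<lambda>y. \<Sum>k\<in>A. f k y) has_derivative (\<lambda>v. \<Sum>k\<in>A. frechet_derivative (f k) (at x) v)) (at x)"
    by (intro has_derivative_sum differentiable_imp_has_derivative assms)
  from partial_deriv_eq[OF this] show ?thesis by (simp add: partial_deriv_def)
qed

lemma partial_deriv_bilinear:
  assumes "bounded_bilinear B" "f differentiable (at x)" "g differentiable (at x)"
  shows "partial_deriv i (\<lambda>y. B (f y) (g y)) x = B (f x) (partial_deriv i g x) + B (partial_deriv i f x) (g x)"
  using partial_deriv_eq[OF bounded_bilinear.FDERIV[OF assms(1) assms(2-3)[THEN differentiable_imp_has_derivative]]]
  by (simp add: partial_deriv_def)

lemma differentiable_bilinear:
  assumes "bounded_bilinear B" "f differentiable (at x)" "g differentiable (at x)"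
  shows "(\<lambda>y. B (f y) (g y)) differentiable (at x)"
  using bounded_bilinear.FDERIV[OF assms(1)] assms(2,3) unfolding differentiable_def by blast

lemmas partial_deriv_mult = partial_deriv_bilinear[OF bounded_bilinear_mult]
lemmas partial_deriv_scaleR = partial_deriv_bilinear[OF bounded_bilinear_scaleR]
lemmas differentiable_scaleR' = differentiable_bilinear[OF bounded_bilinear_scaleR]

lemma partial_deriv_linear:
  assumes "bounded_linear L" "f differentiable (at x)"
  shows "partial_deriv i (\<lambda>y. L (f y)) x = L (partial_deriv i f x)"
  using partial_deriv_eq[OF bounded_linear.has_derivative[OF assms(1) assms(2)[THEN differentiable_imp_has_derivative]]]
  by (simp add: partial_deriv_def)

lemma differentiable_linear:
  assumes "bounded_linear L" "f differentiable (at x)"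
  shows "(\<lambda>y. L (f y)) differentiable (at x)"
  using bounded_linear.has_derivative[OF assms(1)] assms(2) unfolding differentiable_def by blast

lemma partial_deriv_inverse:
  fixes f :: "real^'n::finite \<Rightarrow> real"
  assumes "f differentiable (at x)" "f x \<noteq> 0"
  shows "partial_deriv i (\<lambda>y. inverse (f y)) x = - (partial_deriv i f x) * (inverse (f x) * inverse (f x))"
  using partial_deriv_eq[OF Deriv.has_derivative_inverse[OF assms(2) differentiable_imp_has_derivative[OF assms(1)]]]
  by (simp add: partial_deriv_def)

section \<open>Functions of class \<open>C\<^sup>k\<close>\<close>

lemma Ck_on_cong:
  assumes "open S" "\<And>y. y \<in> S \<Longrightarrow> f y = g y" "Ck_on k S f"
  shows "Ck_on k S g"
  using assms(2,3)
proof (induction k arbitrary: f g)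
  case 0
  then show ?case by (simp cong: continuous_on_cong)
next
  case (Suc k)
  have "g differentiable (at x)" if "x \<in> S" for x
    using differentiable_cong_open[OF assms(1) that Suc.prems(1)] Suc.prems(2) that by simp
  moreover have "Ck_on k S (partial_deriv i g)" for i
  proof (rule Suc.IH)
    show "partial_deriv i f y = partial_deriv i g y" if "y \<in> S" for y
      using partial_deriv_cong[OF assms(1) that Suc.prems(1)] .
    show "Ck_on k S (partial_deriv i f)" using Suc.prems(2) by simp
  qed
  ultimately show ?case by simp
qed

lemma Ck_on_SucD: "Ck_on (Suc k) S f \<Longrightarrow> Ck_on k S f"
proof (induction k arbitrary: f)
  case 0
  then show ?case
    by (auto intro!: continuous_at_imp_continuous_on differentiable_imp_continuous_within)
next
  case (Suc k)
  from Suc.prems have "\<forall>x\<in>S. f differentiable (at x)" "\<And>i. Ck_on (Suc k) S (partial_deriv i f)"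
    by (simp_all del: Ck_on.simps add: Ck_on.simps(2)[of "Suc k"])
  with Suc.IH show ?case by simp
qed

lemma Ck_on_add:
  assumes "open S" "Ck_on k S f" "Ck_on k S g"
  shows "Ck_on k S (\<lambda>y. f y + g y)"
  using assms(2,3)
proof (induction k arbitrary: f g)
  case 0
  then show ?case by (simp add: continuous_on_add)
next
  case (Suc k)
  have "Ck_on k S (partial_deriv i (\<lambda>y. f y + g y))" for i
  proof (rule Ck_on_cong[OF assms(1)])
    show "Ck_on k S (\<lambda>y. partial_deriv i f y + partial_deriv i g y)"
      using Suc.prems by (intro Suc.IH) simp_all
  qed (use Suc.prems in \<open>simp add: partial_deriv_add\<close>)
  with Suc.prems show ?case by auto
qed

lemma Ck_on_bilinear:
  assumes "open S" "bounded_bilinear B" "Ck_on k S f" "Ck_on k S g"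
  shows "Ck_on k S (\<lambda>y. B (f y) (g y))"
  using assms(3,4)
proof (induction k arbitrary: f g)
  case 0
  then show ?case using bounded_bilinear.continuous_on[OF assms(2)] by simp
next
  case (Suc k)
  note low = Ck_on_SucD[OF Suc.prems(1)] Ck_on_SucD[OF Suc.prems(2)]
  have "Ck_on k S (partial_deriv i (\<lambda>y. B (f y) (g y)))" for i
  proof (rule Ck_on_cong[OF assms(1)])
    show "Ck_on k S (\<lambda>y. B (f y) (partial_deriv i g y) + B (partial_deriv i f y) (g y))"
      using Suc.prems low by (intro Ck_on_add[OF assms(1)] Suc.IH) simp_all
  qed (use Suc.prems in \<open>simp add: partial_deriv_bilinear[OF assms(2)]\<close>)
  with Suc.prems show ?case by (auto intro: differentiable_bilinear[OF assms(2)])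
qed

lemma Ck_on_const: "Ck_on k S (\<lambda>y. c)"
  by (induction k arbitrary: c) simp_all

lemma Ck_on_inverse:
  fixes f :: "real^'n::finite \<Rightarrow> real"
  assumes "open S" "Ck_on k S f" "\<And>y. y \<in> S \<Longrightarrow> f y \<noteq> 0"
  shows "Ck_on k S (\<lambda>y. inverse (f y))"
  using assms(2)
proof (induction k)
  case 0
  then show ?case using assms(3) by (simp add: continuous_on_inverse)
next
  case (Suc k)
  note mult = Ck_on_bilinear[OF assms(1) bounded_bilinear_mult]
  have ih: "Ck_on k S (\<lambda>y. inverse (f y))"
    using Suc.IH Ck_on_SucD[OF Suc.prems] by blast
  have "Ck_on k S (partial_deriv i (\<lambda>y. inverse (f y)))" for i
  proof (rule Ck_on_cong[OF assms(1)])
    show "Ck_on k S (\<lambda>y. (- 1) * (partial_deriv i f y * (inverse (f y) * inverse (f y))))"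
      using Suc.prems by (intro mult ih Ck_on_const) auto
  qed (use Suc.prems assms(3) in \<open>auto simp: partial_deriv_inverse\<close>)
  moreover have "(\<lambda>y. inverse (f y)) differentiable (at x)" if "x \<in> S" for x
    using Suc.prems assms(3) that by (auto intro!: differentiable_inverse)
  ultimately show ?case by simp
qed

section \<open>Symmetry of second derivatives\<close>

lemma has_real_derivative_along_axis:
  fixes f :: "real^'n::finite \<Rightarrow> real"
  assumes "f differentiable (at (p + t *\<^sub>R axis i 1))"
  shows "((\<lambda>t. f (p + t *\<^sub>R axis i 1)) has_real_derivative partial_deriv i f (p + t *\<^sub>R axis i 1)) (at t)"
proof -
  have "((\<lambda>t. p + t *\<^sub>R axis i 1) has_derivative (\<lambda>s. 0 + s *\<^sub>R axis i 1)) (at t)"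
    by (intro has_derivative_add has_derivative_const has_derivative_scaleR_left has_derivative_ident)
  then have "((\<lambda>t. p + t *\<^sub>R axis i 1) has_derivative (\<lambda>s. s *\<^sub>R axis i 1)) (at t)"
    by simp
  from has_derivative_compose[OF this differentiable_imp_has_derivative[OF assms]]
  have "((\<lambda>t. f (p + t *\<^sub>R axis i 1)) has_derivative
      (\<lambda>s. frechet_derivative f (at (p + t *\<^sub>R axis i 1)) (s *\<^sub>R axis i 1))) (at t)" .
  then show ?thesis
    unfolding has_field_derivative_def partial_deriv_def
    by (simp add: linear_cmul[OF linear_frechet_derivative[OF assms]] mult_commute_abs)
qed

text \<open>
  The second difference of \<open>f\<close> over a square of side \<open>h\<close> is a difference, in the direction \<open>j\<close>, of
  increments in the direction \<open>i\<close>. One application of the mean value theorem in each direction turns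
  it into \<open>h\<^sup>2\<close> times a mixed derivative at a nearby point. Since the second difference is symmetric
  in \<open>i\<close> and \<open>j\<close>, this is the core of Schwarz's theorem.
\<close>

lemma second_difference_mean_value:
  fixes f :: "real^'n::finite \<Rightarrow> real"
  assumes h: "h > 0" and B: "ball x (3 * h) \<subseteq> S"
    and f: "\<And>y. y \<in> S \<Longrightarrow> f differentiable (at y)"
    and fi: "\<And>y. y \<in> S \<Longrightarrow> partial_deriv i f differentiable (at y)"
  shows "\<exists>p. dist x p < 3 * h \<and>
    f (x + h *\<^sub>R axis i 1 + h *\<^sub>R axis j 1) - f (x + h *\<^sub>R axis i 1) - f (x + h *\<^sub>R axis j 1) + f x
      = h * h * partial_deriv j (partial_deriv i f) p"
proof -
  have near: "dist x (x + s *\<^sub>R axis i 1 + t *\<^sub>R axis j 1) < 3 * h"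
    if "0 \<le> s" "s \<le> h" "0 \<le> t" "t \<le> h" for s t
  proof -
    have "norm (s *\<^sub>R axis i 1 + t *\<^sub>R axis j (1::real)) \<le> \<bar>s\<bar> + \<bar>t\<bar>"
      by (rule order_trans[OF norm_triangle_ineq]) simp
    then have "norm (s *\<^sub>R axis i 1 + t *\<^sub>R axis j (1::real)) < 3 * h"
      using that h by linarith
    moreover have "x - (x + s *\<^sub>R axis i 1 + t *\<^sub>R axis j 1) = - (s *\<^sub>R axis i 1 + t *\<^sub>R axis j (1::real))"
      by simp
    ultimately show ?thesis
      by (simp only: dist_norm norm_minus_cancel)
  qed
  have inS: "x + s *\<^sub>R axis i 1 + t *\<^sub>R axis j 1 \<in> S"
    if "0 \<le> s" "s \<le> h" "0 \<le> t" "t \<le> h" for s t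
    using near[OF that] B by auto
  define \<phi> where "\<phi> s = f (x + h *\<^sub>R axis j 1 + s *\<^sub>R axis i 1) - f (x + s *\<^sub>R axis i 1)" for s
  have "\<exists>s. 0 < s \<and> s < h \<and> \<phi> h - \<phi> 0 = (h - 0) *
     (partial_deriv i f (x + h *\<^sub>R axis j 1 + s *\<^sub>R axis i 1) - partial_deriv i f (x + s *\<^sub>R axis i 1))"
  proof (rule MVT2[OF h])
    fix s assume s: "0 \<le> s" "s \<le> h"
    have "x + h *\<^sub>R axis j 1 + s *\<^sub>R axis i 1 \<in> S" "x + s *\<^sub>R axis i 1 \<in> S"
      using inS[of s h] inS[of s 0] s h by (auto simp: algebra_simps)
    then show "(\<phi> has_real_derivative
       partial_deriv i f (x + h *\<^sub>R axis j 1 + s *\<^sub>R axis i 1) - partial_deriv i f (x + s *\<^sub>R axis i 1)) (at s)"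
      unfolding \<phi>_def using f by (intro DERIV_diff has_real_derivative_along_axis) auto
  qed
  then obtain s where s: "0 < s" "s < h" and e1: "\<phi> h - \<phi> 0 = h *
     (partial_deriv i f (x + h *\<^sub>R axis j 1 + s *\<^sub>R axis i 1) - partial_deriv i f (x + s *\<^sub>R axis i 1))"
    by auto
  have "\<exists>t. 0 < t \<and> t < h \<and>
     partial_deriv i f (x + s *\<^sub>R axis i 1 + h *\<^sub>R axis j 1) - partial_deriv i f (x + s *\<^sub>R axis i 1 + 0 *\<^sub>R axis j 1)
     = (h - 0) * partial_deriv j (partial_deriv i f) (x + s *\<^sub>R axis i 1 + t *\<^sub>R axis j 1)"
    by (rule MVT2[OF h]) (use s fi inS in \<open>auto intro!: has_real_derivative_along_axis\<close>)
  then obtain t where t: "0 < t" "t < h" and e2: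
     "partial_deriv i f (x + s *\<^sub>R axis i 1 + h *\<^sub>R axis j 1) - partial_deriv i f (x + s *\<^sub>R axis i 1)
     = h * partial_deriv j (partial_deriv i f) (x + s *\<^sub>R axis i 1 + t *\<^sub>R axis j 1)"
    by auto
  have "\<phi> h - \<phi> 0 = h * h * partial_deriv j (partial_deriv i f) (x + s *\<^sub>R axis i 1 + t *\<^sub>R axis j 1)"
    using e1 e2 by (simp add: algebra_simps)
  moreover have "\<phi> h - \<phi> 0 = f (x + h *\<^sub>R axis i 1 + h *\<^sub>R axis j 1) - f (x + h *\<^sub>R axis i 1)
      - f (x + h *\<^sub>R axis j 1) + f x"
    by (simp add: \<phi>_def algebra_simps)
  ultimately show ?thesis using near[of s t] s t by (intro exI conjI) auto
qed

lemma partial_deriv_commute_real: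
  fixes f :: "real^'n::finite \<Rightarrow> real"
  assumes S: "open S" "x \<in> S" and C2: "Ck_on 2 S f"
  shows "partial_deriv i (partial_deriv j f) x = partial_deriv j (partial_deriv i f) x"
proof -
  have f: "\<And>y. y \<in> S \<Longrightarrow> f differentiable (at y)"
    and fi: "\<And>y i. y \<in> S \<Longrightarrow> partial_deriv i f differentiable (at y)"
    and cont: "\<And>i j. continuous_on S (partial_deriv i (partial_deriv j f))"
    using C2 by (auto simp: numeral_2_eq_2)
  obtain r where r: "r > 0" "ball x r \<subseteq> S"
    using S open_contains_ball by blast
  \<comment> \<open>The corners and the mean value points stay within \<open>2 h < 3 h \<le> r\<close> of \<open>x\<close>.\<close>
  define h where "h n = r / 3 / real (Suc n)" for n
  have h0: "h n > 0" for n using r by (simp add: h_def)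
  have "h n \<le> r / 3" for n
    using r divide_left_mono[of 1 "real (Suc n)" "r / 3"] unfolding h_def by simp
  then have "3 * h n \<le> r" for n
    using mult_left_mono[of "h n" "r / 3" 3] by simp
  then have hB: "ball x (3 * h n) \<subseteq> S" for n
    using r(2) subset_ball[of "3 * h n" r x] by blast
  have h_lim: "(\<lambda>n. 3 * h n) \<longlonglongrightarrow> 0"
  proof -
    have "(\<lambda>n. 3 * h n) = (\<lambda>n. r * inverse (real (Suc n)))"
      by (rule ext) (simp add: h_def del: of_nat_Suc, simp only: divide_inverse)
    then show ?thesis
      using tendsto_mult_left[OF LIMSEQ_inverse_real_of_nat, of r] by (simp only: mult_zero_right)
  qed
  have key: "\<exists>p q. dist x p < 3 * h n \<and> dist x q < 3 * h n \<and>
      partial_deriv j (partial_deriv i f) p = partial_deriv i (partial_deriv j f) q" for n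
  proof -
    obtain p where p: "dist x p < 3 * h n"
       "f (x + h n *\<^sub>R axis i 1 + h n *\<^sub>R axis j 1) - f (x + h n *\<^sub>R axis i 1) - f (x + h n *\<^sub>R axis j 1) + f x
      = h n * h n * partial_deriv j (partial_deriv i f) p"
      using second_difference_mean_value[OF h0 hB f fi, of n i j] by auto
    obtain q where q: "dist x q < 3 * h n"
       "f (x + h n *\<^sub>R axis j 1 + h n *\<^sub>R axis i 1) - f (x + h n *\<^sub>R axis j 1) - f (x + h n *\<^sub>R axis i 1) + f x
      = h n * h n * partial_deriv i (partial_deriv j f) q"
      using second_difference_mean_value[OF h0 hB f fi, of n j i] by auto
    have "x + h n *\<^sub>R axis j 1 + h n *\<^sub>R axis i 1 = x + h n *\<^sub>R axis i 1 + h n *\<^sub>R axis j 1"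
      by (simp add: add.assoc add.commute[of "h n *\<^sub>R axis j 1"])
    with p(2) q(2)[unfolded this] have "h n * h n * partial_deriv j (partial_deriv i f) p
        = h n * h n * partial_deriv i (partial_deriv j f) q"
      by linarith
    then show ?thesis using p(1) q(1) h0[of n] by auto
  qed
  have "\<exists>pq. \<forall>n. dist x (fst (pq n)) < 3 * h n \<and> dist x (snd (pq n)) < 3 * h n \<and>
      partial_deriv j (partial_deriv i f) (fst (pq n)) = partial_deriv i (partial_deriv j f) (snd (pq n))"
    by (rule choice, rule allI, insert key) simp
  then obtain pq where "\<forall>n. dist x (fst (pq n)) < 3 * h n \<and> dist x (snd (pq n)) < 3 * h n \<and>
      partial_deriv j (partial_deriv i f) (fst (pq n)) = partial_deriv i (partial_deriv j f) (snd (pq n))" ..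
  then have pq: "\<And>n. dist x (fst (pq n)) < 3 * h n" "\<And>n. dist x (snd (pq n)) < 3 * h n"
      "\<And>n. partial_deriv j (partial_deriv i f) (fst (pq n)) = partial_deriv i (partial_deriv j f) (snd (pq n))"
    by blast+
  have lim: "(\<lambda>n. F (p' n)) \<longlonglongrightarrow> F x"
    if "continuous_on S F" "\<And>n. dist x (p' n) < 3 * h n" for F :: "real^'n \<Rightarrow> real" and p'
  proof -
    have "(\<lambda>n. dist (p' n) x) \<longlonglongrightarrow> 0"
    proof (rule tendsto_sandwich[OF _ _ tendsto_const h_lim])
      show "\<forall>\<^sub>F n in sequentially. dist (p' n) x \<le> 3 * h n"
        using that(2) by (intro always_eventually allI) (simp add: dist_commute less_imp_le)
    qed simp
    then have "p' \<longlonglongrightarrow> x" by (rule tendsto_dist_iff[THEN iffD2])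
    moreover have "isCont F x" using that(1) S by (simp add: continuous_on_eq_continuous_at)
    ultimately show ?thesis by (rule isCont_tendsto_compose[rotated])
  qed
  have "(\<lambda>n. partial_deriv j (partial_deriv i f) (fst (pq n))) \<longlonglongrightarrow> partial_deriv j (partial_deriv i f) x"
    by (rule lim[OF cont pq(1)])
  moreover have "(\<lambda>n. partial_deriv i (partial_deriv j f) (snd (pq n))) \<longlonglongrightarrow> partial_deriv i (partial_deriv j f) x"
    by (rule lim[OF cont pq(2)])
  ultimately show ?thesis unfolding pq(3) by (rule LIMSEQ_unique[symmetric])
qed

lemma partial_deriv_commute:
  fixes f :: "real^'n::finite \<Rightarrow> real^'m::finite"
  assumes S: "open S" "x \<in> S" and C2: "Ck_on 2 S f"
  shows "partial_deriv i (partial_deriv j f) x = partial_deriv j (partial_deriv i f) x"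
proof (subst vec_eq_iff, intro allI)
  fix m
  let ?f = "\<lambda>y. f y $ m"
  have f: "\<And>y. y \<in> S \<Longrightarrow> f differentiable (at y)"
    and fi: "\<And>y i. y \<in> S \<Longrightarrow> partial_deriv i f differentiable (at y)"
    using C2 by (auto simp: numeral_2_eq_2)
  have first: "partial_deriv a ?f y = partial_deriv a f y $ m" if "y \<in> S" for a y
    using partial_deriv_linear[OF bounded_linear_vec_nth f[OF that]] .
  have second: "partial_deriv b (partial_deriv a ?f) x = partial_deriv b (partial_deriv a f) x $ m" for a b
    using partial_deriv_cong[OF S first] partial_deriv_linear[OF bounded_linear_vec_nth fi[OF S(2)]] by simp
  have "bounded_bilinear (\<lambda>v u. v $ m * u :: real)"
    by (rule bounded_bilinear.comp1[OF bounded_bilinear_mult bounded_linear_vec_nth])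
  from Ck_on_bilinear[OF S(1) this C2 Ck_on_const[of _ _ 1]]
  have "Ck_on 2 S ?f" by simp
  from partial_deriv_commute_real[OF S this]
  show "partial_deriv i (partial_deriv j f) x $ m = partial_deriv j (partial_deriv i f) x $ m"
    using second by simp
qed


section \<open>The Lorentz product\<close>

lemma bounded_bilinear_lorentz: "bounded_bilinear (lorentz :: 'n::finite minkowski \<Rightarrow> 'n minkowski \<Rightarrow> real)"
proof -
  have "bilinear (lorentz :: 'n minkowski \<Rightarrow> 'n minkowski \<Rightarrow> real)"
    unfolding bilinear_def
    by (intro conjI allI linearI)
       (simp_all add: lorentz_def sum.distrib sum_distrib_left distrib_left distrib_right
        right_diff_distrib mult_ac)
  then show ?thesis by (simp add: bilinear_conv_bounded_bilinear)
qed

lemma lorentz_commute: "lorentz v w = lorentz w v"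
  by (simp add: lorentz_def mult.commute)

lemmas lorentz_simps =
  bounded_bilinear.add_left[OF bounded_bilinear_lorentz]
  bounded_bilinear.add_right[OF bounded_bilinear_lorentz]
  bounded_bilinear.diff_left[OF bounded_bilinear_lorentz]
  bounded_bilinear.diff_right[OF bounded_bilinear_lorentz]
  bounded_bilinear.minus_left[OF bounded_bilinear_lorentz]
  bounded_bilinear.minus_right[OF bounded_bilinear_lorentz]
  bounded_bilinear.zero_left[OF bounded_bilinear_lorentz]
  bounded_bilinear.zero_right[OF bounded_bilinear_lorentz]
  bounded_bilinear.scaleR_left[OF bounded_bilinear_lorentz]
  bounded_bilinear.scaleR_right[OF bounded_bilinear_lorentz]
  bounded_bilinear.sum_left[OF bounded_bilinear_lorentz]
  bounded_bilinear.sum_right[OF bounded_bilinear_lorentz]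

lemma partial_deriv_lorentz:
  assumes "f differentiable (at x)" "h differentiable (at x)"
  shows "partial_deriv i (\<lambda>y. lorentz (f y) (h y)) x
    = lorentz (partial_deriv i f x) (h x) + lorentz (f x) (partial_deriv i h x)"
  using partial_deriv_bilinear[OF bounded_bilinear_lorentz assms] by simp

lemmas differentiable_lorentz = differentiable_bilinear[OF bounded_bilinear_lorentz]

lemma lorentz_e1_right: "lorentz v e1 = - v $ None"
  by (simp add: lorentz_def e1_def axis_def)

lemma lorentz_e1_e1: "lorentz e1 e1 = -1"
  by (subst lorentz_e1_right) (simp add: e1_def axis_def)

text \<open>
  The product is not definite, so a vector is shown to vanish by testing it against all vectors;
  the standard basis vectors already detect each component.
\<close>

lemma lorentz_nondegenerate:
  assumes "\<And>w. lorentz v w = 0"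
  shows "v = 0"
proof (subst vec_eq_iff, intro allI)
  fix a :: "'a option option"
  show "v $ a = 0 $ a"
  proof (cases a)
    case None
    then show ?thesis using assms[of e1] by (simp add: lorentz_e1_right)
  next
    case (Some b)
    have "lorentz v (axis (Some b) 1) = v $ Some b"
      by (simp add: lorentz_def axis_def if_distrib cong: if_cong)
    then show ?thesis using assms Some by simp
  qed
qed

section \<open>Inverse of a metric matrix\<close>

lemma pos_def_matrix_inverse:
  assumes "pos_def_matrix (A :: real^'n::finite^'n)"
  shows "matrix_inv A ** A = mat 1" "A ** matrix_inv A = mat 1" "transpose (matrix_inv A) = matrix_inv A"
    "det A \<noteq> 0"
proof -
  have "v = 0" if "A *v v = 0" for v
  proof (rule ccontr)
    assume "v \<noteq> 0"
    then have "v \<bullet> (A *v v) > 0" using assms by (simp add: pos_def_matrix_def)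
    with that show False by simp
  qed
  then have "\<exists>B. B ** A = mat 1"
    unfolding matrix_left_invertible_ker by blast
  then have inv: "invertible A" by (simp add: invertible_left_inverse)
  then show "det A \<noteq> 0" by (simp add: invertible_det_nz)
  have "\<exists>B. A ** B = mat 1 \<and> B ** A = mat 1" using inv by (simp add: invertible_def)
  then have "A ** matrix_inv A = mat 1 \<and> matrix_inv A ** A = mat 1"
    unfolding matrix_inv_def by (rule someI_ex)
  then show l: "matrix_inv A ** A = mat 1" and r: "A ** matrix_inv A = mat 1" by auto
  have "transpose A = A" using assms by (simp add: pos_def_matrix_def)
  then have t: "transpose (matrix_inv A) ** A = mat 1"
    using arg_cong[OF r, of transpose] by (simp add: matrix_transpose_mul transpose_mat)
  have "transpose (matrix_inv A) = transpose (matrix_inv A) ** (A ** matrix_inv A)"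
    by (simp only: r matrix_mul_rid)
  also have "\<dots> = matrix_inv A"
    by (simp only: matrix_mul_assoc t matrix_mul_lid)
  finally show "transpose (matrix_inv A) = matrix_inv A" .
qed

lemma pos_def_matrix_entries:
  assumes "pos_def_matrix (A :: real^'n::finite^'n)"
  shows "A $ i $ j = A $ j $ i" "matrix_inv A $ i $ j = matrix_inv A $ j $ i"
    "(\<Sum>k\<in>UNIV. matrix_inv A $ i $ k * A $ k $ j) = (if i = j then 1 else 0)"
    "(\<Sum>k\<in>UNIV. A $ i $ k * matrix_inv A $ k $ j) = (if i = j then 1 else 0)"
proof -
  have "transpose A $ i $ j = A $ i $ j" using assms by (simp add: pos_def_matrix_def)
  then show "A $ i $ j = A $ j $ i" by (simp add: transpose_def)
  have "transpose (matrix_inv A) $ i $ j = matrix_inv A $ i $ j"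
    using pos_def_matrix_inverse[OF assms] by simp
  then show "matrix_inv A $ i $ j = matrix_inv A $ j $ i" by (simp add: transpose_def)
  have "(matrix_inv A ** A) $ i $ j = mat 1 $ i $ j" "(A ** matrix_inv A) $ i $ j = mat 1 $ i $ j"
    using pos_def_matrix_inverse[OF assms] by simp_all
  then show "(\<Sum>k\<in>UNIV. matrix_inv A $ i $ k * A $ k $ j) = (if i = j then 1 else 0)"
    "(\<Sum>k\<in>UNIV. A $ i $ k * matrix_inv A $ k $ j) = (if i = j then 1 else 0)"
    by (simp_all add: matrix_matrix_mult_def mat_def)
qed

lemma trace_inverse_metric:
  assumes P: "pos_def_matrix (A :: real^'n::finite^'n)"
  shows "(\<Sum>i\<in>UNIV. \<Sum>j\<in>UNIV. matrix_inv A $ i $ j * A $ i $ j) = real CARD('n)"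
  using pos_def_matrix_entries(3)[OF P] pos_def_matrix_entries(1)[OF P] by simp

lemma matrix_inv_entry_cramer:
  assumes "pos_def_matrix (A :: real^'n::finite^'n)"
  shows "matrix_inv A $ k $ l = det (\<chi> i j. if j = k then axis l 1 $ i else A $ i $ j) / det A"
proof -
  have "A *v column l (matrix_inv A) = axis l 1"
  proof (subst vec_eq_iff, intro allI)
    fix i
    show "(A *v column l (matrix_inv A)) $ i = axis l 1 $ i"
      using pos_def_matrix_entries(4)[OF assms, of i l]
      by (simp add: matrix_vector_mult_def column_def axis_def)
  qed
  then have "column l (matrix_inv A) = (\<chi> k. det (\<chi> i j. if j = k then axis l 1 $ i else A $ i $ j) / det A)"
    using cramer[OF pos_def_matrix_inverse(4)[OF assms]] by blast
  then have "column l (matrix_inv A) $ k = det (\<chi> i j. if j = k then axis l 1 $ i else A $ i $ j) / det A"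
    by simp
  then show ?thesis by (simp add: column_def)
qed

lemma differentiable_prod:
  fixes f :: "'i \<Rightarrow> real^'n::finite \<Rightarrow> real"
  assumes "\<And>i. i \<in> I \<Longrightarrow> f i differentiable (at x)"
  shows "(\<lambda>y. \<Prod>i\<in>I. f i y) differentiable (at x)"
  using assms by (induction I rule: infinite_finite_induct) simp_all

lemma differentiable_det:
  fixes A :: "real^'n::finite \<Rightarrow> real^'m::finite^'m"
  assumes "\<And>i j. (\<lambda>y. A y $ i $ j) differentiable (at x)"
  shows "(\<lambda>y. det (A y)) differentiable (at x)"
  unfolding det_def
proof (intro differentiable_sum ballI differentiable_mult)
  show "(\<lambda>y. \<Prod>i\<in>UNIV. A y $ i $ p i) differentiable (at x)" for p
    by (rule differentiable_prod) (rule assms)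
qed simp_all

text \<open>
  The Christoffel symbols contain the inverse metric and have to be differentiated once more to form
  the curvature. By Cramer's rule the entries of the inverse are quotients of determinants.
\<close>

lemma differentiable_matrix_inv:
  fixes A :: "real^'n::finite \<Rightarrow> real^'m::finite^'m"
  assumes "open S" "x \<in> S" "\<And>y. y \<in> S \<Longrightarrow> pos_def_matrix (A y)"
    and A: "\<And>i j. (\<lambda>y. A y $ i $ j) differentiable (at x)"
  shows "(\<lambda>y. matrix_inv (A y) $ k $ l) differentiable (at x)"
proof (rule differentiable_cong_open[OF assms(1,2)])
  show "(\<lambda>y. det (\<chi> i j. if j = k then axis l 1 $ i else A y $ i $ j) / det (A y)) differentiable (at x)"
  proof (rule differentiable_divide)
    have "(\<lambda>y. (\<chi> i j. if j = k then axis l 1 $ i else A y $ i $ j) $ i $ j) differentiable (at x)" for i j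
    proof (cases "j = k")
      case False
      then show ?thesis using A[of i j] by simp
    qed simp
    then show "(\<lambda>y. det (\<chi> i j. if j = k then axis l 1 $ i else A y $ i $ j)) differentiable (at x)"
      by (rule differentiable_det)
    show "(\<lambda>y. det (A y)) differentiable (at x)"
      using A by (rule differentiable_det)
    show "det (A x) \<noteq> 0" using pos_def_matrix_inverse(4)[OF assms(3)[OF assms(2)]] .
  qed
qed (rule matrix_inv_entry_cramer[OF assms(3), symmetric])

lemma sum_delta_real:
  "(\<Sum>k\<in>UNIV. (if i = (k::'n::finite) then 1 else 0) * f k) = (f i :: real)"
  "(\<Sum>k\<in>UNIV. f k * (if i = (k::'n::finite) then 1 else 0)) = (f i :: real)"
  "(\<Sum>k\<in>UNIV. (if k = (i::'n::finite) then 1 else 0) * f k) = (f i :: real)"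
  "(\<Sum>k\<in>UNIV. f k * (if k = (i::'n::finite) then 1 else 0)) = (f i :: real)"
  by (simp_all add: mult_delta_left mult_delta_right)

text \<open>
  Raising an index solves for the components of a tensor with one lowered index; the next lemma
  is the converse.
\<close>

lemma inverse_metric_raise:
  assumes "pos_def_matrix (A :: real^'n::finite^'n)" and "\<And>j. (\<Sum>l\<in>UNIV. f l * A $ l $ j) = w j"
  shows "f i = (\<Sum>j\<in>UNIV. matrix_inv A $ i $ j * w j)"
proof -
  have "(\<Sum>j\<in>UNIV. matrix_inv A $ i $ j * w j) = (\<Sum>j\<in>UNIV. \<Sum>l\<in>UNIV. f l * (A $ l $ j * matrix_inv A $ j $ i))"
    unfolding assms(2)[symmetric] sum_distrib_left
    by (simp add: pos_def_matrix_entries(2)[OF assms(1), of i] mult_ac)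
  also have "\<dots> = (\<Sum>l\<in>UNIV. f l * (\<Sum>j\<in>UNIV. A $ l $ j * matrix_inv A $ j $ i))"
    by (subst sum.swap) (simp add: sum_distrib_left)
  also have "\<dots> = f i"
    by (simp add: pos_def_matrix_entries(4)[OF assms(1)] sum_delta_real)
  finally show ?thesis by simp
qed

lemma inverse_metric_lower:
  assumes "pos_def_matrix (A :: real^'n::finite^'n)"
  shows "(\<Sum>l\<in>UNIV. (\<Sum>j\<in>UNIV. matrix_inv A $ l $ j * w j) * A $ l $ i) = w i"
proof -
  have "(\<Sum>l\<in>UNIV. (\<Sum>j\<in>UNIV. matrix_inv A $ l $ j * w j) * A $ l $ i)
      = (\<Sum>l\<in>UNIV. \<Sum>j\<in>UNIV. w j * (A $ i $ l * matrix_inv A $ l $ j))"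
    unfolding sum_distrib_right
    by (simp add: pos_def_matrix_entries(1)[OF assms, of _ i] mult_ac)
  also have "\<dots> = (\<Sum>j\<in>UNIV. w j * (\<Sum>l\<in>UNIV. A $ i $ l * matrix_inv A $ l $ j))"
    by (subst sum.swap) (simp add: sum_distrib_left)
  also have "\<dots> = w i"
    by (simp add: pos_def_matrix_entries(4)[OF assms(1)] sum_delta_real)
  finally show ?thesis .
qed


section \<open>Immersions into the light cone\<close>

text \<open>
  The coordinate expression of a spacelike immersion into the light cone. Three derivatives suffice:
  the curvature of the induced metric involves third derivatives of the immersion.
\<close>

locale light_cone_patch =
  fixes S :: "(real^'n::finite) set" and F :: "'n local_map"
  assumes open_S: "open S"
    and C3: "Ck_on 3 S F"
    and light_cone: "x \<in> S \<Longrightarrow> F x \<in> future_light_cone"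
    and pos_def: "x \<in> S \<Longrightarrow> pos_def_matrix (induced_metric F x)"
begin

abbreviation G :: "'n local_metric" where "G \<equiv> induced_metric F"
abbreviation Gi :: "real^'n \<Rightarrow> 'n \<Rightarrow> 'n \<Rightarrow> real" where "Gi x i j \<equiv> matrix_inv (induced_metric F x) $ i $ j"
abbreviation E :: "'n \<Rightarrow> 'n local_map" where "E i \<equiv> partial_deriv i F"
abbreviation \<Gamma> :: "'n \<Rightarrow> 'n \<Rightarrow> 'n \<Rightarrow> real^'n \<Rightarrow> real" where "\<Gamma> \<equiv> christoffel G"

lemma differentiable_immersion:
  assumes "x \<in> S"
  shows "F differentiable (at x)" "E i differentiable (at x)" "partial_deriv j (E i) differentiable (at x)"
  using C3 assms by (simp_all add: numeral_3_eq_3)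

lemma C2_immersion: "Ck_on 2 S F" "Ck_on 2 S (E i)"
  using Ck_on_SucD[of 2 S F] C3 by (simp_all add: numeral_3_eq_3 numeral_2_eq_2)

lemma frame_symmetric: "x \<in> S \<Longrightarrow> partial_deriv i (E j) x = partial_deriv j (E i) x"
  using partial_deriv_commute[OF open_S _ C2_immersion(1)] .

lemma frame_symmetric2:
  "x \<in> S \<Longrightarrow> partial_deriv i (partial_deriv j (E k)) x = partial_deriv j (partial_deriv i (E k)) x"
  using partial_deriv_commute[OF open_S _ C2_immersion(2)] .

lemma metric_entry: "G x $ i $ j = lorentz (E i x) (E j x)"
  by (simp add: induced_metric_def)

lemma partial_deriv_metric:
  assumes "x \<in> S"
  shows "partial_deriv k (\<lambda>y. G y $ i $ j) x
    = lorentz (partial_deriv k (E i) x) (E j x) + lorentz (E i x) (partial_deriv k (E j) x)"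
  unfolding metric_entry using assms differentiable_immersion by (simp add: partial_deriv_lorentz)

text \<open>
  The Koszul formula collapses, because \<open>\<partial>\<^sub>i \<partial>\<^sub>j F\<close> is symmetric in \<open>i\<close> and \<open>j\<close>: the Christoffel symbols
  are the coefficients of the tangential part of the second derivatives.
\<close>

lemma christoffel_eq:
  assumes x: "x \<in> S"
  shows "\<Gamma> k i j x = (\<Sum>l\<in>UNIV. Gi x k l * lorentz (partial_deriv i (E j) x) (E l x))"
proof -
  have "partial_deriv i (\<lambda>y. G y $ j $ l) x + partial_deriv j (\<lambda>y. G y $ i $ l) x
          - partial_deriv l (\<lambda>y. G y $ i $ j) x = 2 * lorentz (partial_deriv i (E j) x) (E l x)" for l
    unfolding partial_deriv_metric[OF x]
    using frame_symmetric[OF x, of i j] frame_symmetric[OF x, of i l] frame_symmetric[OF x, of j l]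
    by (simp add: lorentz_commute)
  then show ?thesis
    unfolding christoffel_def by (simp add: sum_divide_distrib)
qed

lemma christoffel_lower:
  assumes "x \<in> S"
  shows "(\<Sum>k\<in>UNIV. \<Gamma> k i j x * G x $ k $ l) = lorentz (partial_deriv i (E j) x) (E l x)"
  using inverse_metric_lower[OF pos_def[OF assms]] by (simp add: christoffel_eq[OF assms])

lemma differentiable_inverse_metric:
  assumes x: "x \<in> S"
  shows "(\<lambda>y. Gi y k l) differentiable (at x)"
proof (rule differentiable_matrix_inv[OF open_S x pos_def])
  show "(\<lambda>y. G y $ i $ j) differentiable (at x)" for i j
    unfolding metric_entry by (intro differentiable_lorentz differentiable_immersion x)
qed

lemma differentiable_christoffel:
  assumes x: "x \<in> S"
  shows "\<Gamma> k i j differentiable (at x)"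
proof (rule differentiable_cong_open[OF open_S x christoffel_eq[symmetric]])
  show "(\<lambda>y. \<Sum>l\<in>UNIV. Gi y k l * lorentz (partial_deriv i (E j) y) (E l y)) differentiable (at x)"
    by (intro differentiable_sum ballI differentiable_mult differentiable_inverse_metric
        differentiable_lorentz differentiable_immersion x) simp
qed

section \<open>The Gauss equation\<close>

text \<open>
  The second fundamental form, as a vector normal to the immersion.
\<close>

definition second_form :: "'n \<Rightarrow> 'n \<Rightarrow> 'n local_map" where
  "second_form i j x = partial_deriv i (E j) x - (\<Sum>k\<in>UNIV. \<Gamma> k i j x *\<^sub>R E k x)"

lemma differentiable_second_form: "x \<in> S \<Longrightarrow> second_form i j differentiable (at x)"
  unfolding second_form_def[abs_def]
  by (intro differentiable_diff differentiable_immersion differentiable_sum ballI differentiable_scaleR'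
       differentiable_christoffel) auto

lemma second_form_normal:
  assumes "x \<in> S"
  shows "lorentz (second_form i j x) (E l x) = 0"
  using christoffel_lower[OF assms, of i j l]
  by (simp add: second_form_def lorentz_simps metric_entry)

lemma lorentz_second_form:
  assumes "x \<in> S"
  shows "lorentz (second_form i j x) (partial_deriv k (E l) x) = lorentz (second_form i j x) (second_form k l x)"
  using second_form_normal[OF assms, of i j]
  by (simp add: second_form_def[of k l] lorentz_simps)

text \<open>
  The ambient space is flat, in the guise that third derivatives of \<open>F\<close> commute. In the difference
  \<open>\<partial>\<^sub>i II\<^sub>j\<^sub>k - \<partial>\<^sub>j II\<^sub>i\<^sub>k\<close> the third derivatives therefore cancel and the tangential part that
  remains is minus the curvature tensor. Since \<open>II\<close> is normal, the derivative of
  \<open>\<langle>II\<^sub>j\<^sub>k, \<partial>\<^sub>p F\<rangle> = 0\<close> expresses this tangential part through products of two second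
  fundamental forms.
\<close>

theorem gauss_equation:
  assumes x: "x \<in> S"
  shows "(\<Sum>l\<in>UNIV. riemann_tensor G l i j k x * G x $ l $ p)
    = lorentz (second_form j k x) (second_form i p x) - lorentz (second_form i k x) (second_form j p x)"
proof -
  \<comment> \<open>\<open>Q i j\<close> is the half of the lowered curvature tensor in which the derivative \<open>\<partial>\<^sub>i\<close> falls on the
    symbol with lower indices \<open>j k\<close>; the other half arises by exchanging \<open>i\<close> and \<open>j\<close>.\<close>
  define Q where "Q i j = (\<Sum>l\<in>UNIV. (partial_deriv i (\<Gamma> l j k) x
      + (\<Sum>m\<in>UNIV. \<Gamma> l i m x * \<Gamma> m j k x)) * G x $ l $ p)" for i j
  have Q: "Q i j = lorentz (partial_deriv i (partial_deriv j (E k)) x) (E p x)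
      + lorentz (second_form j k x) (second_form i p x)" for i j
  proof -
    have "partial_deriv i (\<lambda>y. lorentz (second_form j k y) (E p y)) x = partial_deriv i (\<lambda>y. 0) x"
      by (rule partial_deriv_cong[OF open_S x second_form_normal])
    then have 1: "lorentz (partial_deriv i (second_form j k) x) (E p x)
        = - lorentz (second_form j k x) (second_form i p x)"
      using x by (simp add: partial_deriv_lorentz differentiable_second_form differentiable_immersion
          lorentz_second_form)
    have "partial_deriv i (second_form j k) x = partial_deriv i (partial_deriv j (E k)) x
       - (\<Sum>m\<in>UNIV. \<Gamma> m j k x *\<^sub>R partial_deriv i (E m) x + partial_deriv i (\<Gamma> m j k) x *\<^sub>R E m x)"
      unfolding second_form_def[abs_def] using x
      by (subst partial_deriv_diff)
         (auto simp: partial_deriv_sum partial_deriv_scaleR differentiable_immersion differentiable_christoffel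
           intro!: differentiable_sum differentiable_scaleR')
    then have "lorentz (partial_deriv i (second_form j k) x) (E p x)
      = lorentz (partial_deriv i (partial_deriv j (E k)) x) (E p x)
       - (\<Sum>m\<in>UNIV. \<Gamma> m j k x * (\<Sum>l\<in>UNIV. \<Gamma> l i m x * G x $ l $ p) + partial_deriv i (\<Gamma> m j k) x * G x $ m $ p)"
      by (simp only: lorentz_simps real_scaleR_def christoffel_lower[OF x, symmetric] metric_entry[symmetric])
    also have "(\<Sum>m\<in>UNIV. \<Gamma> m j k x * (\<Sum>l\<in>UNIV. \<Gamma> l i m x * G x $ l $ p) + partial_deriv i (\<Gamma> m j k) x * G x $ m $ p)
      = Q i j"
    proof -
      have "(\<Sum>m\<in>UNIV. \<Gamma> m j k x * (\<Sum>l\<in>UNIV. \<Gamma> l i m x * G x $ l $ p))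
        = (\<Sum>l\<in>UNIV. (\<Sum>m\<in>UNIV. \<Gamma> l i m x * \<Gamma> m j k x) * G x $ l $ p)"
        unfolding sum_distrib_left sum_distrib_right by (subst sum.swap) (simp add: mult_ac)
      then show ?thesis by (simp add: Q_def sum.distrib distrib_right)
    qed
    finally show ?thesis using 1 by simp
  qed
  have "(\<Sum>l\<in>UNIV. riemann_tensor G l i j k x * G x $ l $ p) = Q i j - Q j i"
    unfolding riemann_tensor_def Q_def sum_subtractf[symmetric]
    by (rule sum.cong) (simp_all add: sum_subtractf algebra_simps)
  then show ?thesis
    unfolding Q using frame_symmetric2[OF x, of i j k] by simp
qed

section \<open>The height function and the null frame\<close>

abbreviation u :: "real^'n \<Rightarrow> real" where "u \<equiv> height F"

lemma height_eq: "height F x = F x $ None"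
  by (simp add: height_def lorentz_e1_right)

lemma height_pos: "x \<in> S \<Longrightarrow> u x > 0"
  using light_cone by (simp add: height_eq future_light_cone_def)

lemma position_null: "x \<in> S \<Longrightarrow> lorentz (F x) (F x) = 0"
  using light_cone by (simp add: future_light_cone_def)

lemma position_normal:
  assumes x: "x \<in> S"
  shows "lorentz (F x) (E i x) = 0"
proof -
  have "partial_deriv i (\<lambda>y. lorentz (F y) (F y)) x = partial_deriv i (\<lambda>y. 0) x"
    by (rule partial_deriv_cong[OF open_S x position_null])
  then show ?thesis
    using x by (simp add: partial_deriv_lorentz differentiable_immersion lorentz_commute)
qed

lemma second_form_position:
  assumes x: "x \<in> S"
  shows "lorentz (second_form i j x) (F x) = - G x $ i $ j"
proof -
  have "partial_deriv i (\<lambda>y. lorentz (F y) (E j y)) x = partial_deriv i (\<lambda>y. 0) x"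
    by (rule partial_deriv_cong[OF open_S x position_normal])
  then have "lorentz (F x) (partial_deriv i (E j) x) = - G x $ i $ j"
    using x by (simp add: partial_deriv_lorentz differentiable_immersion metric_entry)
  moreover have "lorentz (second_form i j x) (F x) = lorentz (F x) (partial_deriv i (E j) x)"
    using position_normal[OF x] by (simp add: second_form_def lorentz_simps lorentz_commute[of _ "F x"])
  ultimately show ?thesis by simp
qed

lemma partial_deriv_height:
  assumes "x \<in> S"
  shows "partial_deriv i u x = - lorentz (E i x) e1"
  using partial_deriv_linear[OF bounded_linear_vec_nth differentiable_immersion(1)[OF assms]]
  by (simp add: height_eq[abs_def] lorentz_e1_right)

lemma partial_deriv2_height:
  assumes x: "x \<in> S"
  shows "partial_deriv i (partial_deriv j u) x = - lorentz (partial_deriv i (E j) x) e1"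
proof -
  have "partial_deriv i (partial_deriv j u) x = partial_deriv i (\<lambda>y. E j y $ None) x"
    by (rule partial_deriv_cong[OF open_S x]) (simp add: partial_deriv_height lorentz_e1_right)
  then show ?thesis
    using partial_deriv_linear[OF bounded_linear_vec_nth differentiable_immersion(2)[OF x]]
    by (simp add: lorentz_e1_right)
qed

lemma differentiable_height:
  assumes x: "x \<in> S"
  shows "u differentiable (at x)" "partial_deriv i u differentiable (at x)"
proof -
  show "u differentiable (at x)"
    using differentiable_linear[OF bounded_linear_vec_nth differentiable_immersion(1)[OF x]]
    by (simp add: height_eq[abs_def])
  show "partial_deriv i u differentiable (at x)"
  proof (rule differentiable_cong_open[OF open_S x])
    show "(\<lambda>y. E i y $ None) differentiable (at x)"
      using differentiable_linear[OF bounded_linear_vec_nth differentiable_immersion(2)[OF x]] .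
  qed (simp add: partial_deriv_height lorentz_e1_right)
qed

lemma hessian_height: "x \<in> S \<Longrightarrow> hessian G u i j x = - lorentz (second_form i j x) e1"
  by (simp add: hessian_def partial_deriv2_height partial_deriv_height second_form_def lorentz_simps sum_negf)

lemma gradient_entry: "gradient G f x $ i = (\<Sum>j\<in>UNIV. Gi x i j * partial_deriv j f x)"
  by (simp add: gradient_def matrix_vector_mult_def)

text \<open>
  As \<open>\<langle>e\<^sub>1, \<partial>\<^sub>i F\<rangle> = - \<partial>\<^sub>i u\<close>, the tangential part of \<open>e\<^sub>1\<close> is the image of \<open>- \<nabla>u\<close>; what is left is
  \<open>e\<^sub>1\<^sup>\<bottom>\<close> in closed form, which makes it visibly differentiable.
\<close>

definition normal_e1 :: "'n local_map" where
  "normal_e1 x = e1 + (\<Sum>i\<in>UNIV. gradient G u x $ i *\<^sub>R E i x)"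

abbreviation grad_sq :: "real^'n \<Rightarrow> real" where "grad_sq x \<equiv> norm_sq G x (gradient G u x)"

lemma normal_e1_tangent:
  assumes x: "x \<in> S"
  shows "lorentz (normal_e1 x) (E j x) = 0"
proof -
  have "(\<Sum>i\<in>UNIV. gradient G u x $ i * lorentz (E i x) (E j x)) = partial_deriv j u x"
    using inverse_metric_lower[OF pos_def[OF x], of "\<lambda>j. partial_deriv j u x" j]
    by (simp add: gradient_entry metric_entry)
  then show ?thesis
    by (simp add: normal_e1_def lorentz_simps partial_deriv_height[OF x] lorentz_commute[of e1])
qed

lemma frechet_derivative_immersion:
  "x \<in> S \<Longrightarrow> frechet_derivative F (at x) v = (\<Sum>i\<in>UNIV. v $ i *\<^sub>R E i x)"
  by (rule frechet_derivative_eq_sum_partial_deriv[OF differentiable_immersion(1)])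

lemma lorentz_frechet_derivative:
  assumes "x \<in> S"
  shows "lorentz (frechet_derivative F (at x) v) (frechet_derivative F (at x) w) = v \<bullet> (G x *v w)"
  by (simp add: frechet_derivative_immersion[OF assms] lorentz_simps inner_vec_def matrix_vector_mult_def
      metric_entry sum_distrib_left mult_ac) (rule sum.swap)

text \<open>
  The tangent spaces are spacelike, hence contain no null vectors.
\<close>

lemma null_tangent_eq_0:
  assumes "x \<in> S" "lorentz (frechet_derivative F (at x) v) (frechet_derivative F (at x) v) = 0"
  shows "v = 0"
  using pos_def[OF assms(1)] assms(2) unfolding pos_def_matrix_def lorentz_frechet_derivative[OF assms(1)]
  by (metis less_irrefl)

lemma tangential_eq:
  assumes x: "x \<in> S" and n: "\<And>j. lorentz (v - frechet_derivative F (at x) w) (E j x) = 0"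
  shows "tangential F x v = frechet_derivative F (at x) w"
  unfolding tangential_def
proof (rule the_equality)
  let ?D = "frechet_derivative F (at x)"
  have lin: "linear ?D" by (rule linear_frechet_derivative[OF differentiable_immersion(1)[OF x]])
  have n': "lorentz (v - ?D w) (?D z) = 0" for z
    using n by (simp only: frechet_derivative_immersion[OF x, of z] lorentz_simps) simp
  then show "?D w \<in> tangent_space F x \<and> (\<forall>s\<in>tangent_space F x. lorentz (v - ?D w) s = 0)"
    by (auto simp: tangent_space_def)
  fix t assume t: "t \<in> tangent_space F x \<and> (\<forall>s\<in>tangent_space F x. lorentz (v - t) s = 0)"
  then obtain z where z: "t = ?D z" by (auto simp: tangent_space_def)
  have diff: "?D (z - w) = t - ?D w" by (simp add: linear_diff[OF lin] z)
  have "lorentz (v - t) (?D (z - w)) = 0" using t by (auto simp: tangent_space_def)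
  with n'[of "z - w"] have "lorentz (?D (z - w)) (?D (z - w)) = 0"
    unfolding diff by (simp add: lorentz_simps)
  then have "z - w = 0" by (rule null_tangent_eq_0[OF x])
  then show "t = ?D w" by (simp add: z)
qed

lemma normal_part_e1:
  assumes x: "x \<in> S"
  shows "normal_part F x e1 = normal_e1 x"
proof -
  have "tangential F x e1 = frechet_derivative F (at x) (- gradient G u x)"
  proof (rule tangential_eq[OF x])
    have "e1 - frechet_derivative F (at x) (- gradient G u x) = normal_e1 x"
      by (simp add: frechet_derivative_immersion[OF x] normal_e1_def sum_negf)
    then show "lorentz (e1 - frechet_derivative F (at x) (- gradient G u x)) (E j x) = 0" for j
      using normal_e1_tangent[OF x] by simp
  qed
  then show ?thesis
    by (simp add: normal_part_def frechet_derivative_immersion[OF x] normal_e1_def sum_negf)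
qed

lemma eta_eq:
  assumes "x \<in> S"
  shows "eta F x = - ((1 + grad_sq x) / (2 * (u x)\<^sup>2)) *\<^sub>R F x + (1 / u x) *\<^sub>R normal_e1 x"
  by (simp add: eta_def Let_def xi_def normal_part_e1[OF assms])

lemma differentiable_eta:
  assumes x: "x \<in> S"
  shows "eta F differentiable (at x)"
proof (rule differentiable_cong_open[OF open_S x eta_eq[symmetric]])
  have g: "(\<lambda>y. gradient G u y $ i) differentiable (at x)" for i
    unfolding gradient_entry
    by (intro differentiable_sum ballI differentiable_mult differentiable_inverse_metric differentiable_height x) simp
  have n: "normal_e1 differentiable (at x)"
    unfolding normal_e1_def[abs_def]
    by (intro differentiable_add differentiable_const differentiable_sum ballI differentiable_scaleR' g
        differentiable_immersion x) simp
  have m: "(\<lambda>y. G y $ i $ j) differentiable (at x)" for i j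
    unfolding metric_entry by (intro differentiable_lorentz differentiable_immersion x)
  have q: "grad_sq differentiable (at x)"
    unfolding norm_sq_def inner_vec_def matrix_vector_mult_def
    by (auto intro!: differentiable_sum differentiable_mult g m)
  show "(\<lambda>y. - ((1 + grad_sq y) / (2 * (u y)\<^sup>2)) *\<^sub>R F y + (1 / u y) *\<^sub>R normal_e1 y) differentiable (at x)"
    using height_pos[OF x]
    by (intro differentiable_add differentiable_scaleR' differentiable_minus differentiable_divide
        differentiable_mult differentiable_power differentiable_const q n differentiable_height
        differentiable_immersion x) auto
qed

lemma eta_normal: "x \<in> S \<Longrightarrow> lorentz (eta F x) (E j x) = 0"
  by (simp add: eta_eq lorentz_simps position_normal normal_e1_tangent)

lemma lorentz_normal_e1:
  assumes x: "x \<in> S"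
  shows "lorentz (F x) (normal_e1 x) = - u x" "lorentz (normal_e1 x) (normal_e1 x) = - (1 + grad_sq x)"
proof -
  show "lorentz (F x) (normal_e1 x) = - u x"
    by (simp add: normal_e1_def lorentz_simps position_normal[OF x] height_def)
  define T where "T = (\<Sum>i\<in>UNIV. gradient G u x $ i *\<^sub>R E i x)"
  have n: "normal_e1 x = e1 + T" by (simp add: normal_e1_def T_def)
  have "T = frechet_derivative F (at x) (gradient G u x)"
    by (simp add: T_def frechet_derivative_immersion[OF x])
  then have "lorentz T T = grad_sq x"
    by (simp add: lorentz_frechet_derivative[OF x] norm_sq_def)
  moreover have "lorentz (normal_e1 x) T = 0"
    by (simp add: T_def lorentz_simps normal_e1_tangent[OF x])
  ultimately show "lorentz (normal_e1 x) (normal_e1 x) = - (1 + grad_sq x)"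
    by (simp add: n lorentz_simps lorentz_e1_e1 lorentz_commute[of T e1])
qed

lemma null_frame:
  assumes x: "x \<in> S"
  shows "lorentz (F x) (eta F x) = -1" "lorentz (eta F x) (eta F x) = 0"
proof -
  have u: "u x \<noteq> 0" using height_pos[OF x] by simp
  show "lorentz (F x) (eta F x) = -1"
    using u by (simp add: eta_eq[OF x] lorentz_simps position_null[OF x] lorentz_normal_e1[OF x])
  show "lorentz (eta F x) (eta F x) = 0"
    using u by (simp add: eta_eq[OF x] lorentz_simps position_null[OF x] lorentz_normal_e1[OF x]
        lorentz_commute[of "normal_e1 x" "F x"] power2_eq_square field_simps)
qed

section \<open>Scalar curvature\<close>

text \<open>
  The component \<open>\<langle>II, \<eta>\<rangle>\<close> of the second fundamental form, expressed through the metric and the height.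
\<close>

definition eta_form :: "'n \<Rightarrow> 'n \<Rightarrow> real^'n \<Rightarrow> real" where
  "eta_form i j x = (1 + grad_sq x) / (2 * (u x)\<^sup>2) * G x $ i $ j - hessian G u i j x / u x"

lemma second_form_eta:
  assumes x: "x \<in> S"
  shows "lorentz (second_form i j x) (eta F x) = eta_form i j x"
proof -
  have "lorentz (second_form i j x) (normal_e1 x) = lorentz (second_form i j x) e1"
    by (simp add: normal_e1_def lorentz_simps second_form_normal[OF x])
  then show ?thesis
    by (simp add: eta_eq[OF x] lorentz_simps second_form_position[OF x] hessian_height[OF x] eta_form_def)
qed

text \<open>
  The tangent vectors and the null frame together are \<open>n + 2\<close> vectors, and they are independent: their
  Gram matrix is the induced metric next to a hyperbolic plane. So they span Minkowski space, and
  nothing but \<open>0\<close> is orthogonal to all of them.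
\<close>

lemma normal_eq_0:
  assumes x: "x \<in> S" and w: "\<And>i. lorentz w (E i x) = 0" "lorentz w (F x) = 0" "lorentz w (eta F x) = 0"
  shows "w = 0"
proof (rule lorentz_nondegenerate)
  \<comment> \<open>\<open>L\<close> sends the standard basis to these vectors. The two extra coordinates are used for the null
    frame, so that \<open>L\<close> is an endomorphism and injectivity gives surjectivity.\<close>
  define L :: "'n minkowski \<Rightarrow> 'n minkowski" where
    "L v = frechet_derivative F (at x) (\<chi> i. v $ Some (Some i)) + v $ Some None *\<^sub>R F x + v $ None *\<^sub>R eta F x" for v
  have L: "L v = (\<Sum>i\<in>UNIV. v $ Some (Some i) *\<^sub>R E i x) + v $ Some None *\<^sub>R F x + v $ None *\<^sub>R eta F x" for v
    unfolding L_def frechet_derivative_immersion[OF x] by simp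
  have lin: "linear L"
    by (rule linearI) (simp_all add: L scaleR_add_left sum.distrib scaleR_add_right scaleR_sum_right)
  have swap: "lorentz (E i x) (F x) = 0" "lorentz (eta F x) (F x) = -1" "lorentz (E i x) (eta F x) = 0" for i
    using position_normal[OF x] null_frame(1)[OF x] eta_normal[OF x] by (simp_all add: lorentz_commute)
  have "inj L"
    unfolding linear_injective_0[OF lin]
  proof (intro allI impI)
    fix v assume v: "L v = 0"
    have "lorentz (L v) (F x) = - v $ None"
      by (simp add: L lorentz_simps position_null[OF x] swap)
    with v have v1: "v $ None = 0" by (simp add: lorentz_simps)
    have "lorentz (L v) (eta F x) = - v $ Some None"
      by (simp add: L lorentz_simps null_frame[OF x] swap)
    with v have v2: "v $ Some None = 0" by (simp add: lorentz_simps)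
    let ?w = "\<chi> i. v $ Some (Some i)"
    have "frechet_derivative F (at x) ?w = 0" using v v1 v2 by (simp add: L_def)
    then have "?w = 0"
      by (intro null_tangent_eq_0[OF x]) (simp add: lorentz_simps)
    then have v3: "v $ Some (Some i) = 0" for i by (simp add: vec_eq_iff)
    show "v = 0"
    proof (subst vec_eq_iff, intro allI)
      fix a show "v $ a = 0 $ a"
        using v1 v2 v3 by (cases a) (simp, rename_tac b, case_tac b, simp_all)
    qed
  qed
  then have "surj L" by (rule linear_injective_imp_surjective[OF lin _ refl])
  fix z
  from \<open>surj L\<close> obtain v where "z = L v" by blast
  then show "lorentz w z = 0" using w by (simp add: L lorentz_simps)
qed

lemma second_form_decomposition:
  assumes x: "x \<in> S"
  shows "second_form i j x = G x $ i $ j *\<^sub>R eta F x - eta_form i j x *\<^sub>R F x"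
proof -
  have "second_form i j x - (G x $ i $ j *\<^sub>R eta F x - eta_form i j x *\<^sub>R F x) = 0"
    by (rule normal_eq_0[OF x])
       (simp_all add: lorentz_simps second_form_normal[OF x] second_form_position[OF x] second_form_eta[OF x]
         eta_normal[OF x] position_normal[OF x] null_frame[OF x] position_null[OF x] lorentz_commute[of "eta F x" "F x"])
  then show ?thesis by simp
qed

text \<open>
  One of the two components of the second fundamental form in the null frame is the metric itself
  (\<open>\<langle>II, \<xi>\<rangle> = - g\<close>). In the Gauss equation the curvature thereby becomes linear in the other one.
\<close>

lemma lorentz_second_forms:
  assumes x: "x \<in> S"
  shows "lorentz (second_form i j x) (second_form k l x) = G x $ i $ j * eta_form k l x + G x $ k $ l * eta_form i j x"
  by (simp add: second_form_decomposition[OF x, of k l] lorentz_simps second_form_eta[OF x] second_form_position[OF x])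

definition eta_trace :: "real^'n \<Rightarrow> real" where
  "eta_trace x = (\<Sum>i\<in>UNIV. \<Sum>j\<in>UNIV. Gi x i j * eta_form i j x)"

lemmas trace_metric = trace_inverse_metric[OF pos_def]

lemma eta_trace_eq:
  assumes x: "x \<in> S"
  shows "eta_trace x = real CARD('n) * (1 + grad_sq x) / (2 * (u x)\<^sup>2) - laplacian G u x / u x"
proof -
  have "eta_trace x = (1 + grad_sq x) / (2 * (u x)\<^sup>2) * (\<Sum>i\<in>UNIV. \<Sum>j\<in>UNIV. Gi x i j * G x $ i $ j) - laplacian G u x / u x"
    unfolding eta_trace_def eta_form_def laplacian_def
    by (simp add: right_diff_distrib sum_subtractf sum_distrib_left sum_divide_distrib mult_ac)
  then show ?thesis by (simp add: trace_metric[OF x])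
qed

text \<open>
  By the previous lemma the curvature tensor is the Kulkarni--Nomizu product of the metric with
  \<open>\<langle>II, \<eta>\<rangle>\<close>. Contracting once gives \<open>g tr + n \<langle>II, \<eta>\<rangle> - 2 \<langle>II, \<eta>\<rangle>\<close>, contracting again \<open>(2 n - 2) tr\<close>.
\<close>

theorem scalar_curvature_eq:
  assumes x: "x \<in> S"
  shows "scalar_curvature G x = 2 * (real CARD('n) - 1) * eta_trace x"
proof -
  note P = pos_def[OF x]
  let ?g = "\<lambda>i j. G x $ i $ j" and ?B = "\<lambda>i j. eta_form i j x" and ?n = "real CARD('n)"
  have R: "riemann_tensor G i i j k x = (\<Sum>p\<in>UNIV. Gi x i p *
      ((?g j k * ?B i p + ?g i p * ?B j k) - (?g i k * ?B j p + ?g j p * ?B i k)))" for i j k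
    by (rule inverse_metric_raise[OF P, of "\<lambda>l. riemann_tensor G l i j k x"])
       (simp add: gauss_equation[OF x] lorentz_second_forms[OF x])
  have "ricci G j k x = ?g j k * eta_trace x + (?n - 2) * ?B j k" for j k
  proof -
    have "ricci G j k x = ?g j k * eta_trace x + (\<Sum>i\<in>UNIV. \<Sum>p\<in>UNIV. Gi x i p * ?g i p) * ?B j k
       - (\<Sum>i\<in>UNIV. \<Sum>p\<in>UNIV. Gi x i p * ?g i k * ?B j p)
       - (\<Sum>i\<in>UNIV. \<Sum>p\<in>UNIV. Gi x i p * ?g j p * ?B i k)"
      unfolding ricci_def R eta_trace_def
      by (simp add: sum.distrib sum_subtractf right_diff_distrib distrib_left sum_distrib_left sum_distrib_right mult_ac)
    also have "(\<Sum>i\<in>UNIV. \<Sum>p\<in>UNIV. Gi x i p * ?g i k * ?B j p) = (\<Sum>p\<in>UNIV. (\<Sum>i\<in>UNIV. Gi x p i * ?g i k) * ?B j p)"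
      by (subst sum.swap) (simp add: sum_distrib_right pos_def_matrix_entries(2)[OF P])
    also have "\<dots> = ?B j k"
      by (simp add: pos_def_matrix_entries(3)[OF P] sum_delta_real)
    also have "(\<Sum>i\<in>UNIV. \<Sum>p\<in>UNIV. Gi x i p * ?g j p * ?B i k) = (\<Sum>i\<in>UNIV. (\<Sum>p\<in>UNIV. ?g j p * Gi x p i) * ?B i k)"
      by (simp add: sum_distrib_left pos_def_matrix_entries(2)[OF P, of _ i for i] mult_ac)
    also have "\<dots> = ?B j k"
      by (simp add: pos_def_matrix_entries(4)[OF P] sum_delta_real)
    finally show ?thesis unfolding trace_metric[OF x] by (simp add: algebra_simps)
  qed
  then have "scalar_curvature G x
      = (\<Sum>j\<in>UNIV. \<Sum>k\<in>UNIV. Gi x j k * (?g j k * eta_trace x + (?n - 2) * ?B j k))"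
    by (simp add: scalar_curvature_def)
  also have "\<dots> = (\<Sum>j\<in>UNIV. \<Sum>k\<in>UNIV. Gi x j k * ?g j k) * eta_trace x
      + (?n - 2) * (\<Sum>j\<in>UNIV. \<Sum>k\<in>UNIV. Gi x j k * ?B j k)"
    by (simp add: sum.distrib distrib_left sum_distrib_left sum_distrib_right mult_ac)
  finally show ?thesis unfolding trace_metric[OF x] eta_trace_def[symmetric] by (simp add: algebra_simps)
qed

section \<open>Null expansions\<close>

text \<open>
  The tangential part is found by raising an index, which avoids inverting the differential of \<open>F\<close>.
\<close>

lemma null_expansion_eq:
  assumes x: "x \<in> S" and \<zeta>: "\<zeta> differentiable (at x)"
  shows "null_expansion F \<zeta> x
    = (\<Sum>i\<in>UNIV. \<Sum>j\<in>UNIV. Gi x i j * lorentz (partial_deriv i \<zeta> x) (E j x)) / real CARD('n)"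
proof -
  let ?D = "frechet_derivative F (at x)"
  define Y where "Y X = (\<chi> i. \<Sum>j\<in>UNIV. Gi x i j * lorentz (frechet_derivative \<zeta> (at x) X) (E j x))" for X
  have "tangential F x (frechet_derivative \<zeta> (at x) X) = ?D (Y X)" for X
  proof (rule tangential_eq[OF x])
    fix j
    have "lorentz (?D (Y X)) (E j x) = (\<Sum>l\<in>UNIV. Y X $ l * G x $ l $ j)"
      by (simp add: frechet_derivative_immersion[OF x] lorentz_simps metric_entry)
    also have "\<dots> = lorentz (frechet_derivative \<zeta> (at x) X) (E j x)"
      unfolding Y_def using inverse_metric_lower[OF pos_def[OF x]] by simp
    finally show "lorentz (frechet_derivative \<zeta> (at x) X - ?D (Y X)) (E j x) = 0"
      by (simp add: lorentz_simps)
  qed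
  moreover have inj: "?D v = ?D w \<Longrightarrow> v = w" for v w
  proof -
    assume "?D v = ?D w"
    then have "?D (v - w) = 0"
      by (simp add: linear_diff[OF linear_frechet_derivative[OF differentiable_immersion(1)[OF x]]])
    then have "v - w = 0"
      by (intro null_tangent_eq_0[OF x]) (simp add: lorentz_simps)
    then show "v = w" by simp
  qed
  ultimately have "shape_operator F \<zeta> x X = Y X" for X
    unfolding shape_operator_def by (intro the_equality) auto
  then have "trace (matrix (shape_operator F \<zeta> x)) = (\<Sum>i\<in>UNIV. Y (axis i 1) $ i)"
    by (simp add: trace_def matrix_def)
  then show ?thesis
    by (simp add: null_expansion_def Y_def partial_deriv_def)
qed

text \<open>
  The position vector is normal and its derivative is the differential of the immersion.
\<close>

lemma null_expansion_xi:
  assumes x: "x \<in> S"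
  shows "null_expansion F (xi F) x = 1"
  using trace_metric[OF x]
  by (simp add: null_expansion_eq[OF x] differentiable_immersion[OF x] xi_def metric_entry)

text \<open>
  Weingarten's equation: \<open>\<eta>\<close> stays normal, so its derivative is dual to \<open>- \<langle>II, \<eta>\<rangle>\<close>.
\<close>

lemma null_expansion_eta:
  assumes x: "x \<in> S"
  shows "null_expansion F (eta F) x = - eta_trace x / real CARD('n)"
proof -
  have "lorentz (partial_deriv i (eta F) x) (E j x) = - eta_form i j x" for i j
  proof -
    have "partial_deriv i (\<lambda>y. lorentz (eta F y) (E j y)) x = partial_deriv i (\<lambda>y. 0) x"
      by (rule partial_deriv_cong[OF open_S x eta_normal])
    then have "lorentz (partial_deriv i (eta F) x) (E j x) = - lorentz (eta F x) (partial_deriv i (E j) x)"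
      using x by (simp add: partial_deriv_lorentz differentiable_eta differentiable_immersion)
    also have "lorentz (eta F x) (partial_deriv i (E j) x) = lorentz (second_form i j x) (eta F x)"
      by (simp add: second_form_def lorentz_simps lorentz_commute[of _ "eta F x"] eta_normal[OF x])
    finally show ?thesis by (simp add: second_form_eta[OF x])
  qed
  then show ?thesis
    by (simp add: null_expansion_eq[OF x differentiable_eta[OF x]] eta_trace_def sum_negf)
qed

end


section \<open>Conformal change of the Laplacian\<close>

definition grad_inner :: "'n::finite local_metric \<Rightarrow> (real^'n \<Rightarrow> real) \<Rightarrow> (real^'n \<Rightarrow> real) \<Rightarrow> real^'n \<Rightarrow> real" where
  "grad_inner G a b x = (\<Sum>i\<in>UNIV. \<Sum>j\<in>UNIV. matrix_inv (G x) $ i $ j * (partial_deriv i a x * partial_deriv j b x))"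

lemma grad_inner_commute:
  assumes "pos_def_matrix (G x)"
  shows "grad_inner G a b x = grad_inner G b a x"
  unfolding grad_inner_def
  by (subst sum.swap) (simp add: pos_def_matrix_entries(2)[OF assms] mult_ac cong: sum.cong)

lemma norm_sq_gradient:
  assumes P: "pos_def_matrix (G x)"
  shows "norm_sq G x (gradient G f x) = grad_inner G f f x"
proof -
  have "G x *v gradient G f x = (\<chi> i. partial_deriv i f x)"
    by (simp add: gradient_def matrix_vector_mul_assoc pos_def_matrix_inverse[OF P])
  then show ?thesis
    by (simp add: norm_sq_def gradient_def inner_vec_def matrix_vector_mult_def grad_inner_def
        sum_distrib_left mult_ac)
qed

lemma grad_inner_self_nonneg:
  assumes P: "pos_def_matrix (G x)"
  shows "grad_inner G f f x \<ge> 0"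
  unfolding norm_sq_gradient[of G x, OF P, symmetric] norm_sq_def
  using P unfolding pos_def_matrix_def by (cases "gradient G f x = 0") (auto simp: less_imp_le)

lemma grad_inner_mult_left:
  assumes "a differentiable (at x)" "b differentiable (at x)"
  shows "grad_inner G (\<lambda>y. a y * b y) c x = a x * grad_inner G b c x + b x * grad_inner G a c x"
  by (simp add: grad_inner_def partial_deriv_mult[OF assms] distrib_left distrib_right sum.distrib
      sum_distrib_left mult_ac)

lemma laplacian_mult:
  assumes S: "open S" "x \<in> S" and P: "pos_def_matrix (G x)"
    and d: "\<And>y. y \<in> S \<Longrightarrow> a differentiable (at y)" "\<And>y. y \<in> S \<Longrightarrow> b differentiable (at y)"
    and d2: "\<And>i. partial_deriv i a differentiable (at x)" "\<And>i. partial_deriv i b differentiable (at x)"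
  shows "laplacian G (\<lambda>y. a y * b y) x = a x * laplacian G b x + b x * laplacian G a x + 2 * grad_inner G a b x"
proof -
  note dx = d[OF S(2)]
  have first: "partial_deriv j (\<lambda>y. a y * b y) y = a y * partial_deriv j b y + partial_deriv j a y * b y"
    if "y \<in> S" for j y
    using partial_deriv_mult[OF d(1)[OF that] d(2)[OF that]] .
  have second: "partial_deriv i (partial_deriv j (\<lambda>y. a y * b y)) x
    = a x * partial_deriv i (partial_deriv j b) x + partial_deriv i a x * partial_deriv j b x
      + (partial_deriv j a x * partial_deriv i b x + partial_deriv i (partial_deriv j a) x * b x)" for i j
    using partial_deriv_cong[OF S first] dx d2
    by (simp add: partial_deriv_add partial_deriv_mult)
  have hess: "hessian G (\<lambda>y. a y * b y) i j x = a x * hessian G b i j x + b x * hessian G a i j x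
      + (partial_deriv i a x * partial_deriv j b x + partial_deriv i b x * partial_deriv j a x)" for i j
    unfolding hessian_def second first[OF S(2)]
    by (simp add: right_diff_distrib distrib_left sum.distrib sum_distrib_left mult_ac)
  have "laplacian G (\<lambda>y. a y * b y) x
     = a x * laplacian G b x + b x * laplacian G a x + (grad_inner G a b x + grad_inner G b a x)"
    unfolding laplacian_def hess grad_inner_def
    by (simp add: distrib_left sum.distrib sum_distrib_left mult_ac)
  then show ?thesis using grad_inner_commute[of G x, OF P, of b a] by simp
qed

lemma pos_def_matrix_scaleR:
  assumes "c > 0" "pos_def_matrix A"
  shows "pos_def_matrix (c *\<^sub>R A)"
proof -
  have "transpose (c *\<^sub>R A) = c *\<^sub>R transpose A" by (simp add: transpose_def vec_eq_iff)
  moreover have "v \<bullet> (c *\<^sub>R A *v v) = c * (v \<bullet> (A *v v))" for v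
    by (simp add: scaleR_matrix_vector_assoc[symmetric])
  ultimately show ?thesis using assms by (simp add: pos_def_matrix_def)
qed

lemma matrix_inv_scaleR:
  assumes "c > 0" "pos_def_matrix A"
  shows "matrix_inv (c *\<^sub>R A) $ i $ j = matrix_inv A $ i $ j / c"
proof -
  let ?I = "matrix_inv A" and ?J = "matrix_inv (c *\<^sub>R A)"
  have r: "(c *\<^sub>R A) ** ((1/c) *\<^sub>R ?I) = mat 1"
    using pos_def_matrix_inverse(2)[OF assms(2)] assms(1)
    by (simp add: scalar_matrix_assoc[symmetric] matrix_scalar_ac)
  have "?J = ?J ** ((c *\<^sub>R A) ** ((1/c) *\<^sub>R ?I))"
    by (simp only: r matrix_mul_rid)
  also have "\<dots> = (1/c) *\<^sub>R ?I"
    by (simp only: matrix_mul_assoc pos_def_matrix_inverse(1)[OF pos_def_matrix_scaleR[OF assms]] matrix_mul_lid)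
  finally show ?thesis by simp
qed

lemma christoffel_conformal:
  assumes S: "open S" "x \<in> S" and P: "pos_def_matrix (G x)" and l: "l x > 0" "l differentiable (at x)"
    and G: "\<And>i j. (\<lambda>y. G y $ i $ j) differentiable (at x)"
    and H: "\<And>y. y \<in> S \<Longrightarrow> H y = (l y)\<^sup>2 *\<^sub>R G y"
  shows "christoffel H k i j x = christoffel G k i j x
    + ((if k = j then 1 else 0) * partial_deriv i l x + (if k = i then 1 else 0) * partial_deriv j l x
      - G x $ i $ j * (\<Sum>m\<in>UNIV. matrix_inv (G x) $ k $ m * partial_deriv m l x)) / l x"
proof -
  let ?I = "\<lambda>a b. matrix_inv (G x) $ a $ b"
  have l2: "(l x)\<^sup>2 > 0" using l(1) by simp
  have dH: "partial_deriv a (\<lambda>y. H y $ b $ c) x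
      = (l x)\<^sup>2 * partial_deriv a (\<lambda>y. G y $ b $ c) x + 2 * l x * partial_deriv a l x * G x $ b $ c" for a b c
  proof -
    have "partial_deriv a (\<lambda>y. H y $ b $ c) x = partial_deriv a (\<lambda>y. (l y * l y) * G y $ b $ c) x"
      by (rule partial_deriv_cong[OF S]) (simp add: H power2_eq_square)
    then show ?thesis using l G
      by (simp add: partial_deriv_mult power2_eq_square algebra_simps)
  qed
  have iH: "matrix_inv (H x) $ k $ m = ?I k m / (l x)\<^sup>2" for m
    unfolding H[OF S(2)] by (rule matrix_inv_scaleR[OF l2 P])
  have rearrange: "I / (l x)\<^sup>2 * (((l x)\<^sup>2 * A + 2 * l x * a * p) + ((l x)\<^sup>2 * B + 2 * l x * b * q)
        - ((l x)\<^sup>2 * C + 2 * l x * c * r))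
      = I * (A + B - C) + 2 / l x * (I * p * a + I * q * b - r * (I * c))" for I A B C a b c p q r
    using l(1) by (simp add: field_simps power2_eq_square)
  have delta: "(\<Sum>m\<in>UNIV. ?I k m * G x $ a $ m) = (if k = a then 1 else 0)" for a
    using pos_def_matrix_entries(3)[OF P, of k a] by (simp only: pos_def_matrix_entries(1)[OF P, of a])
  have "christoffel H k i j x = (\<Sum>m\<in>UNIV. ?I k m * (partial_deriv i (\<lambda>y. G y $ j $ m) x
      + partial_deriv j (\<lambda>y. G y $ i $ m) x - partial_deriv m (\<lambda>y. G y $ i $ j) x)
      + 2 / l x * (?I k m * G x $ j $ m * partial_deriv i l x + ?I k m * G x $ i $ m * partial_deriv j l x
         - G x $ i $ j * (?I k m * partial_deriv m l x))) / 2"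
    unfolding christoffel_def dH iH rearrange ..
  also have "\<dots> = christoffel G k i j x
      + 1 / l x * ((\<Sum>m\<in>UNIV. ?I k m * G x $ j $ m) * partial_deriv i l x + (\<Sum>m\<in>UNIV. ?I k m * G x $ i $ m) * partial_deriv j l x
         - G x $ i $ j * (\<Sum>m\<in>UNIV. ?I k m * partial_deriv m l x))"
    unfolding christoffel_def sum.distrib sum_subtractf sum_distrib_left[symmetric] sum_distrib_right[symmetric]
    using l(1) by (simp add: field_simps)
  finally show ?thesis by (simp add: delta)
qed

text \<open>
  The Christoffel symbols change by \<open>(\<delta>\<^sup>k\<^sub>j \<partial>\<^sub>i l + \<delta>\<^sup>k\<^sub>i \<partial>\<^sub>j l - g\<^sub>i\<^sub>j \<nabla>\<^sup>k l) / l\<close>, whose trace in \<open>i, j\<close> is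
  \<open>(2 - n) \<nabla>\<^sup>k l / l\<close>.
\<close>

theorem laplacian_conformal:
  fixes G :: "'n::finite local_metric"
  assumes S: "open S" "x \<in> S" and P: "pos_def_matrix (G x)" and l: "l x > 0" "l differentiable (at x)"
    and G: "\<And>i j. (\<lambda>y. G y $ i $ j) differentiable (at x)"
    and H: "\<And>y. y \<in> S \<Longrightarrow> H y = (l y)\<^sup>2 *\<^sub>R G y"
  shows "laplacian H f x = (laplacian G f x + (real CARD('n) - 2) * grad_inner G l f x / l x) / (l x)\<^sup>2"
proof -
  let ?I = "\<lambda>a b. matrix_inv (G x) $ a $ b" and ?l = "\<lambda>i. partial_deriv i l x" and ?f = "\<lambda>i. partial_deriv i f x"
  have l2: "(l x)\<^sup>2 > 0" using l(1) by simp
  have iH: "matrix_inv (H x) $ k $ m = ?I k m / (l x)\<^sup>2" for k m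
    unfolding H[OF S(2)] by (rule matrix_inv_scaleR[OF l2 P])
  have gi: "grad_inner G l f x = (\<Sum>k\<in>UNIV. (\<Sum>m\<in>UNIV. ?I k m * ?l m) * ?f k)"
    unfolding grad_inner_commute[of G x, OF P, of l f] unfolding grad_inner_def by (simp add: sum_distrib_left sum_distrib_right mult_ac)
  note chr = christoffel_conformal[of S x G l H, OF S P l G H]
  have hess: "hessian H f i j x = hessian G f i j x - (?l i * ?f j + ?l j * ?f i - G x $ i $ j * grad_inner G l f x) / l x" for i j
  proof -
    have "(\<Sum>k\<in>UNIV. christoffel H k i j x * ?f k) = (\<Sum>k\<in>UNIV. christoffel G k i j x * ?f k)
       + (\<Sum>k\<in>UNIV. (if k = j then 1 else 0) * (?l i * ?f k) + (if k = i then 1 else 0) * (?l j * ?f k)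
          - G x $ i $ j * ((\<Sum>m\<in>UNIV. ?I k m * ?l m) * ?f k)) / l x"
      unfolding sum.distrib[symmetric] sum_divide_distrib
      by (rule sum.cong) (simp_all add: chr add_divide_distrib diff_divide_distrib algebra_simps)
    also have "(\<Sum>k\<in>UNIV. (if k = j then 1 else 0) * (?l i * ?f k) + (if k = i then 1 else 0) * (?l j * ?f k)
          - G x $ i $ j * ((\<Sum>m\<in>UNIV. ?I k m * ?l m) * ?f k))
        = ?l i * ?f j + ?l j * ?f i - G x $ i $ j * grad_inner G l f x"
      unfolding gi sum_subtractf sum.distrib sum_delta_real sum_distrib_left[symmetric] ..
    finally show ?thesis unfolding hessian_def by simp
  qed
  have "laplacian H f x = (\<Sum>i\<in>UNIV. \<Sum>j\<in>UNIV. ?I i j * (hessian G f i j x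
      - (?l i * ?f j + ?f i * ?l j - G x $ i $ j * grad_inner G l f x) / l x)) / (l x)\<^sup>2"
    unfolding laplacian_def hess iH by (simp add: sum_divide_distrib mult_ac)
  also have "(\<Sum>i\<in>UNIV. \<Sum>j\<in>UNIV. ?I i j * (hessian G f i j x
      - (?l i * ?f j + ?f i * ?l j - G x $ i $ j * grad_inner G l f x) / l x))
     = laplacian G f x - (grad_inner G l f x + grad_inner G f l x
       - (\<Sum>i\<in>UNIV. \<Sum>j\<in>UNIV. ?I i j * G x $ i $ j) * grad_inner G l f x) / l x"
    unfolding laplacian_def grad_inner_def[of G l f] grad_inner_def[of G f l] sum_distrib_right sum_divide_distrib
      sum_subtractf[symmetric] sum.distrib[symmetric]
    by (intro sum.cong refl) (simp add: algebra_simps diff_divide_distrib add_divide_distrib)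
  finally show ?thesis
    unfolding trace_inverse_metric[OF P] grad_inner_commute[of G x, OF P, of f l]
    by (simp add: diff_divide_distrib algebra_simps)
qed

section \<open>Locality of the curvature quantities\<close>

text \<open>
  In a chart the given metric agrees with the metric induced by the rescaled immersion on an open
  set only, not as a function; these lemmas transfer the curvature and the Laplacian.
\<close>

lemma christoffel_cong:
  assumes "open S" "x \<in> S" "\<And>y. y \<in> S \<Longrightarrow> G y = H y"
  shows "christoffel G k i j x = christoffel H k i j x"
proof -
  have "partial_deriv a (\<lambda>y. G y $ b $ c) x = partial_deriv a (\<lambda>y. H y $ b $ c) x" for a b c
    by (rule partial_deriv_cong[OF assms(1,2)]) (simp add: assms(3))
  then show ?thesis unfolding christoffel_def assms(3)[OF assms(2)] by simp
qed

lemma laplacian_cong: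
  assumes "open S" "x \<in> S" "\<And>y. y \<in> S \<Longrightarrow> G y = H y"
  shows "laplacian G f x = laplacian H f x"
proof -
  have "christoffel G k i j x = christoffel H k i j x" for k i j
    by (rule christoffel_cong[OF assms])
  then show ?thesis unfolding laplacian_def hessian_def assms(3)[OF assms(2)] by simp
qed

lemma scalar_curvature_cong:
  assumes "open S" "x \<in> S" "\<And>y. y \<in> S \<Longrightarrow> G y = H y"
  shows "scalar_curvature G x = scalar_curvature H x"
proof -
  have "partial_deriv a (christoffel G k i j) x = partial_deriv a (christoffel H k i j) x" for a k i j
    by (rule partial_deriv_cong[OF assms(1,2)]) (rule christoffel_cong[OF assms(1) _ assms(3)])
  moreover have "christoffel G k i j x = christoffel H k i j x" for k i j
    by (rule christoffel_cong[OF assms])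
  ultimately show ?thesis
    unfolding scalar_curvature_def ricci_def riemann_tensor_def assms(3)[OF assms(2)] by simp
qed

lemma laplacian_of_constant:
  assumes "open S" "x \<in> S" "\<And>y. y \<in> S \<Longrightarrow> f y = c"
  shows "laplacian G f x = 0"
proof -
  have first: "partial_deriv j f y = 0" if "y \<in> S" for j y
    using partial_deriv_cong[OF assms(1) that assms(3)] by simp
  have "partial_deriv i (partial_deriv j f) x = 0" for i j
    using partial_deriv_cong[OF assms(1,2) first] by simp
  then show ?thesis by (simp add: laplacian_def hessian_def first[OF assms(2)])
qed

section \<open>Subharmonicity of the conformal factor\<close>

text \<open>
  Here \<open>L\<close> abbreviates Laplacians and \<open>D\<close> products of gradients of the factor \<open>l\<close> and of the heights \<open>v\<close>
  and \<open>u = l v\<close>, all taken in the metric of the rescaled immersion. Expanding the trace of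
  \<open>\<langle>II, \<eta>\<rangle>\<close> for \<open>u\<close> in terms of \<open>l\<close> and \<open>v\<close>, the mixed terms \<open>Dlv\<close> cancel with total coefficient
  \<open>n - 2 - (n - 2)\<close>, and what remains apart from the trace for \<open>v\<close> is
  \<open>(4 - n) Dll / (2 l\<^sup>2) - Ll / l\<close>. This is where dimension at most four enters.
\<close>

lemma conformal_factor_inequality:
  fixes n l v Ll Lv Lu Dll Dvv Duu Dlv Dlu :: real
  assumes n: "2 \<le> n" "n \<le> 4" and l: "l > 0" and v: "v > 0" and "Dll \<ge> 0"
    and scal: "0 \<le> 2 * (n - 1) * (n * (1 + Dvv) / (2 * v\<^sup>2) - Lv / v)"
    and tr: "n * (1 + Duu / l\<^sup>2) / (2 * (l * v)\<^sup>2) - (Lu + (n - 2) * Dlu / l) / l\<^sup>2 / (l * v) < 0"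
    and "Duu = l\<^sup>2 * Dvv + 2 * l * v * Dlv + v\<^sup>2 * Dll" "Dlu = l * Dlv + v * Dll"
      "Lu = l * Lv + v * Ll + 2 * Dlv"
  shows "Ll > 0"
proof -
  have "l\<^sup>2 * (n * (1 + Duu / l\<^sup>2) / (2 * (l * v)\<^sup>2) - (Lu + (n - 2) * Dlu / l) / l\<^sup>2 / (l * v))
    = (n * (1 + Dvv) / (2 * v\<^sup>2) - Lv / v) + (4 - n) / 2 * Dll / l\<^sup>2 - Ll / l"
    using l v by (simp add: assms(8-10) field_simps power2_eq_square)
  moreover have "l\<^sup>2 * (n * (1 + Duu / l\<^sup>2) / (2 * (l * v)\<^sup>2) - (Lu + (n - 2) * Dlu / l) / l\<^sup>2 / (l * v)) < 0"
    using tr l by (simp add: mult_pos_neg)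
  moreover have "n * (1 + Dvv) / (2 * v\<^sup>2) - Lv / v \<ge> 0"
    using scal n by (simp add: zero_le_mult_iff)
  moreover have "(4 - n) / 2 * Dll / l\<^sup>2 \<ge> 0" using n \<open>Dll \<ge> 0\<close> by simp
  ultimately have "Ll / l > 0" by linarith
  then show ?thesis using l by (simp add: zero_less_divide_iff)
qed

context light_cone_patch
begin

context
  fixes l :: "real^'n \<Rightarrow> real"
  assumes l3: "Ck_on 3 S l" and l_pos: "\<And>y. y \<in> S \<Longrightarrow> l y > 0"
begin

text \<open>
  Dividing by the conformal factor moves the image along the null lines of the cone. Only the
  \<open>dF / l\<close> part of the differential contributes to the induced metric, since the position vector is
  null and orthogonal to the tangent vectors.
\<close>

definition rescaled :: "'n local_map" where "rescaled y = inverse (l y) *\<^sub>R F y"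

lemma differentiable_factor: "y \<in> S \<Longrightarrow> l differentiable (at y)" "y \<in> S \<Longrightarrow> partial_deriv i l differentiable (at y)"
  using l3 by (simp_all add: numeral_3_eq_3)

lemma induced_metric_rescaled:
  assumes y: "y \<in> S"
  shows "induced_metric F y = (l y)\<^sup>2 *\<^sub>R induced_metric rescaled y"
proof -
  have l0: "l y \<noteq> 0" using l_pos[OF y] by simp
  have il: "(\<lambda>y. inverse (l y)) differentiable (at y)"
    by (rule differentiable_inverse[OF differentiable_factor(1)[OF y] l0])
  have "partial_deriv i rescaled y = inverse (l y) *\<^sub>R E i y + partial_deriv i (\<lambda>y. inverse (l y)) y *\<^sub>R F y" for i
    unfolding rescaled_def[abs_def] by (rule partial_deriv_scaleR[OF il differentiable_immersion(1)[OF y]])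
  moreover have "lorentz (E i y) (F y) = 0" for i
    using position_normal[OF y] by (simp add: lorentz_commute)
  ultimately have "lorentz (partial_deriv i rescaled y) (partial_deriv j rescaled y)
      = inverse (l y) * (inverse (l y) * lorentz (E i y) (E j y))" for i j
    by (simp add: lorentz_simps position_null[OF y] position_normal[OF y])
  moreover have "(l y)\<^sup>2 * (inverse (l y) * (inverse (l y) * t)) = t" for t
    using l0 by (simp add: power2_eq_square field_simps)
  ultimately show ?thesis
    by (simp add: vec_eq_iff induced_metric_def)
qed

lemma light_cone_patch_rescaled: "light_cone_patch S rescaled"
proof
  show "Ck_on 3 S rescaled"
    unfolding rescaled_def[abs_def] using l_pos
    by (intro Ck_on_bilinear[OF open_S bounded_bilinear_scaleR] Ck_on_inverse[OF open_S l3] C3) force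
  fix y assume y: "y \<in> S"
  show "rescaled y \<in> future_light_cone"
    using light_cone[OF y] l_pos[OF y]
    by (simp add: future_light_cone_def rescaled_def lorentz_simps)
  have "induced_metric rescaled y = inverse ((l y)\<^sup>2) *\<^sub>R induced_metric F y"
    using l_pos[OF y] by (simp add: induced_metric_rescaled[OF y])
  then show "pos_def_matrix (induced_metric rescaled y)"
    using pos_def_matrix_scaleR[OF _ pos_def[OF y]] l_pos[OF y] by simp
qed (rule open_S)

text \<open>
  Both immersions, \<open>F\<close> and its rescaling, satisfy the formulas of this locale: for the rescaling the
  sign of the trace of \<open>\<langle>II, \<eta>\<rangle>\<close> is that of the scalar curvature, for \<open>F\<close> it is opposite to that of the
  expansion. The conformal change of the Laplacian compares the two.
\<close>

theorem laplacian_conformal_factor_pos: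
  assumes x: "x \<in> S" and n: "2 \<le> CARD('n)" "CARD('n) \<le> 4"
    and scal: "0 \<le> scalar_curvature (induced_metric rescaled) x"
    and trapped: "null_expansion F (eta F) x > 0"
  shows "laplacian (induced_metric rescaled) l x > 0"
proof -
  interpret R: light_cone_patch S rescaled by (rule light_cone_patch_rescaled)
  let ?K = "induced_metric rescaled" and ?n = "real CARD('n)" and ?v = "height rescaled"
  note P = R.pos_def[OF x]
  have G_diff: "(\<lambda>y. ?K y $ i $ j) differentiable (at x)" for i j
    unfolding R.metric_entry by (intro differentiable_lorentz R.differentiable_immersion x)
  have conf: "laplacian G f x = (laplacian ?K f x + (?n - 2) * grad_inner ?K l f x / l x) / (l x)\<^sup>2" for f
    by (rule laplacian_conformal[where G = ?K and H = G, OF open_S x P l_pos[OF x] differentiable_factor(1)[OF x]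
      G_diff induced_metric_rescaled])
  have u: "u y = l y * ?v y" if "y \<in> S" for y
    using l_pos[OF that] by (simp add: height_eq R.height_eq rescaled_def)
  have du: "partial_deriv i u x = partial_deriv i (\<lambda>y. l y * ?v y) x" for i
    by (rule partial_deriv_cong[OF open_S x u])
  have Lu: "laplacian ?K u x = laplacian ?K (\<lambda>y. l y * ?v y) x"
  proof -
    have "partial_deriv i (partial_deriv j u) x = partial_deriv i (partial_deriv j (\<lambda>y. l y * ?v y)) x" for i j
      by (rule partial_deriv_cong[OF open_S x]) (rule partial_deriv_cong[OF open_S _ u])
    then show ?thesis unfolding laplacian_def hessian_def du by simp
  qed
  note dl = differentiable_factor(1)[OF x] and dv = R.differentiable_height(1)[OF x]
  have Duu: "grad_inner ?K u u x = (l x)\<^sup>2 * grad_inner ?K ?v ?v x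
      + 2 * l x * ?v x * grad_inner ?K l ?v x + (?v x)\<^sup>2 * grad_inner ?K l l x"
    and Dlu: "grad_inner ?K l u x = l x * grad_inner ?K l ?v x + ?v x * grad_inner ?K l l x"
  proof -
    let ?w = "\<lambda>y. l y * ?v y"
    have [simp]: "grad_inner ?K u u x = grad_inner ?K ?w ?w x" "grad_inner ?K l u x = grad_inner ?K l ?w x"
      by (simp_all add: grad_inner_def du)
    have lw: "grad_inner ?K c ?w x = l x * grad_inner ?K c ?v x + ?v x * grad_inner ?K c l x" for c
      unfolding grad_inner_commute[of ?K x, OF P, of c] by (rule grad_inner_mult_left[OF dl dv])
    show "grad_inner ?K l u x = l x * grad_inner ?K l ?v x + ?v x * grad_inner ?K l l x"
      by (simp add: lw)
    show "grad_inner ?K u u x = (l x)\<^sup>2 * grad_inner ?K ?v ?v x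
      + 2 * l x * ?v x * grad_inner ?K l ?v x + (?v x)\<^sup>2 * grad_inner ?K l l x"
      by (simp add: grad_inner_mult_left[OF dl dv] lw grad_inner_commute[of ?K x, OF P, of ?v l] power2_eq_square algebra_simps)
  qed
  have gF: "grad_sq x = grad_inner ?K u u x / (l x)\<^sup>2"
    unfolding norm_sq_gradient[of G x, OF pos_def[OF x]] grad_inner_def induced_metric_rescaled[OF x]
    using l_pos[OF x] by (simp add: matrix_inv_scaleR[OF _ P] sum_divide_distrib)
  show ?thesis
  proof (rule conformal_factor_inequality[where n = ?n and l = "l x" and v = "?v x" and Ll = "laplacian ?K l x"
        and Lv = "laplacian ?K ?v x" and Lu = "laplacian ?K u x" and Dll = "grad_inner ?K l l x"
        and Dvv = "grad_inner ?K ?v ?v x" and Duu = "grad_inner ?K u u x" and Dlv = "grad_inner ?K l ?v x"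
        and Dlu = "grad_inner ?K l u x"])
    show "0 \<le> 2 * (?n - 1) * (?n * (1 + grad_inner ?K ?v ?v x) / (2 * (?v x)\<^sup>2) - laplacian ?K ?v x / ?v x)"
      using scal unfolding R.scalar_curvature_eq[OF x] R.eta_trace_eq[OF x] norm_sq_gradient[of ?K x, OF P] .
    have "eta_trace x < 0" using trapped by (simp add: null_expansion_eta[OF x] divide_less_0_iff)
    then show "?n * (1 + grad_inner ?K u u x / (l x)\<^sup>2) / (2 * (l x * ?v x)\<^sup>2)
      - (laplacian ?K u x + (?n - 2) * grad_inner ?K l u x / l x) / (l x)\<^sup>2 / (l x * ?v x) < 0"
      unfolding eta_trace_eq[OF x] gF conf u[OF x] .
    show "laplacian ?K u x = l x * laplacian ?K ?v x + ?v x * laplacian ?K l x + 2 * grad_inner ?K l ?v x"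
      unfolding Lu
      by (rule laplacian_mult[of S x ?K, OF open_S x P]) (simp_all add: differentiable_factor R.differentiable_height x)
    show "0 \<le> grad_inner ?K l l x" by (rule grad_inner_self_nonneg[of ?K x, OF P])
    show "2 \<le> ?n" "?n \<le> 4" using n by simp_all
  qed (use l_pos[OF x] R.height_pos[OF x] Duu Dlu in simp_all)
qed

end
end

section \<open>Nonexistence of trapped immersions\<close>

theorem theorem4p10:
  fixes X :: "'a topology"
    and \<A> :: "('a, 'n::finite) chart set"
    and g :: "('a, 'n) metric"
  assumes "2 \<le> CARD('n)" and "CARD('n) \<le> 4"
    and "smooth_manifold X \<A>"
    and "topspace X \<noteq> {}" and "connected_space X"
    and "riemannian_metric \<A> g"
    and "parabolic X \<A> g"
    and "nonneg_scalar_curvature \<A> g"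
  shows "\<not> (\<exists>(\<psi> :: 'a \<Rightarrow> 'n minkowski) (lam :: 'a \<Rightarrow> real).
            spacelike_immersion \<A> \<psi> \<and>
            \<psi> ` topspace X \<subseteq> future_light_cone \<and>
            trapped \<A> \<psi> \<and>
            smooth_map \<A> lam \<and>
            (\<forall>p\<in>topspace X. lam p > 0) \<and>
            bdd_above (lam ` topspace X) \<and>
            conformal_pullback \<A> g \<psi> lam)"
proof (intro notI, elim exE conjE)
  fix \<psi> :: "'a \<Rightarrow> 'n minkowski" and lam :: "'a \<Rightarrow> real"
  assume \<psi>: "spacelike_immersion \<A> \<psi>" "\<psi> ` topspace X \<subseteq> future_light_cone" "trapped \<A> \<psi>"
    and lam: "smooth_map \<A> lam" "\<forall>p\<in>topspace X. lam p > 0" "bdd_above (lam ` topspace X)"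
    and conf: "conformal_pullback \<A> g \<psi> lam"
  have charts: "(\<Union>c\<in>\<A>. fst c) = topspace X" and open_chart: "\<And>c. c \<in> \<A> \<Longrightarrow> open (codomain c)"
    using assms(3) unfolding smooth_manifold_def by auto
  have point: "inv_into (fst c) (snd c) y \<in> topspace X" if "c \<in> \<A>" "y \<in> codomain c" for c y
    using charts that inv_into_into[of y "snd c" "fst c"] unfolding codomain_def by blast
  have patch: "light_cone_patch (codomain c) (in_chart c \<psi>)" if c: "c \<in> \<A>" for c
  proof
    show "Ck_on 3 (codomain c) (in_chart c \<psi>)"
      using \<psi>(1) c unfolding spacelike_immersion_def smooth_map_def smooth_on_def by blast
    show "in_chart c \<psi> x \<in> future_light_cone" if "x \<in> codomain c" for x
      using point[OF c that] \<psi>(2) by (auto simp: in_chart_def)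
    show "pos_def_matrix (induced_metric (in_chart c \<psi>) x)" if "x \<in> codomain c" for x
      using \<psi>(1) c that unfolding spacelike_immersion_def by blast
  qed (rule open_chart[OF c])
  obtain p where "p \<in> topspace X" using assms(4) by blast
  then obtain c0 where c0: "c0 \<in> \<A>" "snd c0 p \<in> codomain c0"
    using charts unfolding codomain_def by blast
  \<comment> \<open>The expansion along \<open>\<xi>\<close> is \<open>1\<close>, so the alternative of negative expansions is excluded at
    the chosen point, and with it everywhere.\<close>
  have eta_pos: "null_expansion (in_chart c \<psi>) (eta (in_chart c \<psi>)) x > 0" if "c \<in> \<A>" "x \<in> codomain c" for c x
    using \<psi>(3) that c0 light_cone_patch.null_expansion_xi[OF patch[OF c0(1)] c0(2)]
    unfolding trapped_def Let_def by fastforce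
  have pos: "0 < laplacian (g c) (in_chart c lam) x" if c: "c \<in> \<A>" and x: "x \<in> codomain c" for c x
  proof -
    interpret light_cone_patch "codomain c" "in_chart c \<psi>" by (rule patch[OF c])
    let ?l = "in_chart c lam" and ?R = "rescaled (in_chart c lam)"
    have l3: "Ck_on 3 (codomain c) ?l"
      using lam(1) c unfolding smooth_map_def smooth_on_def by blast
    have l_pos: "?l y > 0" if "y \<in> codomain c" for y
      using lam(2) point[OF c that] by (simp add: in_chart_def)
    have metric: "induced_metric ?R y = g c y" if y: "y \<in> codomain c" for y
    proof -
      have "(?l y)\<^sup>2 *\<^sub>R induced_metric ?R y = (?l y)\<^sup>2 *\<^sub>R g c y"
        using induced_metric_rescaled[OF l3 l_pos y] conf c y unfolding conformal_pullback_def by metis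
      then show ?thesis using l_pos[OF y] by simp
    qed
    have "0 \<le> scalar_curvature (induced_metric ?R) x"
      using assms(8) c x scalar_curvature_cong[OF open_S x metric]
      unfolding nonneg_scalar_curvature_def by simp
    from laplacian_conformal_factor_pos[OF l3 l_pos x assms(1,2) this eta_pos[OF c x]]
    show ?thesis using laplacian_cong[OF open_S x metric] by simp
  qed
  then have "subharmonic \<A> g lam"
    using lam(1) unfolding subharmonic_def by (auto simp: less_imp_le)
  then have "lam constant_on topspace X"
    using assms(7) lam(3) unfolding parabolic_def by blast
  then obtain k where k: "\<And>p. p \<in> topspace X \<Longrightarrow> lam p = k"
    unfolding constant_on_def by blast
  have "laplacian (g c0) (in_chart c0 lam) (snd c0 p) = 0"
    by (rule laplacian_of_constant[OF open_chart[OF c0(1)] c0(2), of _ k])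
       (simp add: in_chart_def k point[OF c0(1)])
  with pos[OF c0] show False by simp
qed

end
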